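(* Let $k$ and $d$ be positive integers such that $n=d/k$ is an integer, assume that $n\ge 2$, and let $$S=\Big\{x\in\{0,1\}^d : \forall j\in\{1,\dots,k\},\ \sum_{i=(j-1)n+1}^{jn}x(i)=1\Big\}.$$ Then any (possibly randomized) learning algorithm for the multitask bandit problem, i.e. for the bandit combinatorial optimization game with action set $S$ and horizon $T$, must incur at least $$\widetilde{\Omega}\big(k^{3/2}\sqrt{dT}\big)$$ expected regret in the worst case, that is, against some sequence of loss vectors $\ell_1,\dots,\ell_T\in[0,1]^d$ fixed in advance.
   Context: Bandit combinatorial optimization game with action set $S\subseteq\{0,1\}^d$ and horizon $T$: an oblivious environment fixes loss vectors $\ell_1,\dots,\ell_T\in[0,1]^d$ before the game begins. On each round $t=1,\dots,T$ the learner picks, possibly at random, an action $x_t\in S$ (depending on its internal randomness and on the losses observed in the previous rounds), incurs the loss $\ell_t\cdot x_t$ (standard inner product), and observes only the number $\ell_t\cdot x_t$. The expected regret is $$R_T=\mathbb{E}\Big[\sum_{t=1}^T\ell_t\cdot x_t\Big]-\min_{x\in S}\sum_{t=1}^T\ell_t\cdot x,$$ where the expectation is over the learner's random choices. The action set in the claim is that of the multitask bandit problem: the learner simultaneously plays $k$ instances of the $n$-armed bandit problem, choosing one arm in each, and observes only the sum of the $k$ corresponding losses. The notation $\widetilde{\Omega}(\cdot)$ denotes a lower bound up to a universal constant and logarithmic factors; here the hidden logarithmic factor is $\log^{-1/2}T$.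
   Formalization: The bound is stated for horizons T ≥ kd; for all T it fails, since the regret is at most kT, which is below the claimed k^{3/2}√(dT) (up to constant and log factor) for fixed T and large kd, and log^{-1/2} T is undefined at T = 1. *)

theory Defs
  imports "HOL-Probability.Probability"
begin

text \<open>
  A vector in \<open>\<real>\<^sup>d\<close> is a function on \<^typ>\<open>nat\<close> of which only the coordinates
  \<open>1, \<dots>, d\<close> matter. Actions are \<^const>\<open>extensional\<close>, so that distinct functions are distinct
  vectors and the action set is finite.
\<close>

type_synonym vector = "nat \<Rightarrow> real"

definition dot :: "nat \<Rightarrow> vector \<Rightarrow> vector \<Rightarrow> real" where
  "dot d u v = (\<Sum>i = 1..d. u i * v i)"

definition multitask_actions :: "nat \<Rightarrow> nat \<Rightarrow> vector set" where
  "multitask_actions d k =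
     (let n = d div k in
      {x \<in> {1..d} \<rightarrow>\<^sub>E {0, 1}. \<forall>j \<in> {1..k}. (\<Sum>i = (j - 1) * n + 1..j * n. x i) = 1})"

text \<open>
  A deterministic algorithm maps the list of the losses observed so far (oldest first) to the next
  action. Its own past actions are determined by that list, so they need not be arguments.
\<close>

type_synonym algorithm = "real list \<Rightarrow> vector"

primrec observations :: "nat \<Rightarrow> algorithm \<Rightarrow> (nat \<Rightarrow> vector) \<Rightarrow> nat \<Rightarrow> real list" where
  "observations d A loss 0 = []"
| "observations d A loss (Suc t) =
     observations d A loss t @ [dot d (loss (Suc t)) (A (observations d A loss t))]"

definition action :: "nat \<Rightarrow> algorithm \<Rightarrow> (nat \<Rightarrow> vector) \<Rightarrow> nat \<Rightarrow> vector" where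
  "action d A loss t = A (observations d A loss (t - 1))"

definition total_loss :: "nat \<Rightarrow> nat \<Rightarrow> algorithm \<Rightarrow> (nat \<Rightarrow> vector) \<Rightarrow> real" where
  "total_loss d T A loss = (\<Sum>t = 1..T. dot d (loss t) (action d A loss t))"

text \<open>
  A randomized algorithm is a random deterministic algorithm: all internal randomness is drawn
  before the first round. Algorithms driven by a random seed from an arbitrary probability space
  are of this form, see \<open>randomized_algorithm_of_seed\<close> and \<open>expected_regret_of_seed\<close> below;
  working with the law of the induced deterministic algorithm avoids a type variable for the seed,
  on which an existentially quantified constant could formally depend.
\<close>

definition randomized_algorithm :: "vector set \<Rightarrow> algorithm measure \<Rightarrow> bool" where
  "randomized_algorithm S P \<longleftrightarrow> prob_space P \<and> (\<forall>h. (\<lambda>A. A h) \<in> measurable P (count_space S))"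

definition expected_regret ::
    "nat \<Rightarrow> vector set \<Rightarrow> nat \<Rightarrow> algorithm measure \<Rightarrow> (nat \<Rightarrow> vector) \<Rightarrow> real" where
  "expected_regret d S T P loss =
     (\<integral>A. total_loss d T A loss \<partial>P) - (MIN x\<in>S. \<Sum>t = 1..T. dot d (loss t) x)"

lemma finite_multitask_actions: "finite (multitask_actions d k)"
proof -
  have "multitask_actions d k \<subseteq> {1..d} \<rightarrow>\<^sub>E {0, 1}"
    by (auto simp: multitask_actions_def Let_def)
  then show ?thesis
    by (rule finite_subset) (intro finite_PiE, auto)
qed

lemma measurable_observations:
  assumes S: "countable S" and A: "\<And>h. (\<lambda>\<omega>. A \<omega> h) \<in> measurable M (count_space S)"
  shows "\<exists>I. countable I \<and> (\<lambda>\<omega>. observations d (A \<omega>) loss t) \<in> measurable M (count_space I)"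
proof (induction t)
  case 0
  show ?case
    by (intro exI[of _ "{[]}"]) auto
next
  case (Suc t)
  then obtain I where I: "countable I"
    and m: "(\<lambda>\<omega>. observations d (A \<omega>) loss t) \<in> measurable M (count_space I)"
    by blast
  let ?J = "(\<lambda>(h, x). h @ [dot d (loss (Suc t)) x]) ` (I \<times> S)"
  have "(\<lambda>\<omega>. observations d (A \<omega>) loss t @ [dot d (loss (Suc t)) (A \<omega> (observations d (A \<omega>) loss t))])
      \<in> measurable M (count_space ?J)"
  proof (rule measurable_compose_countable'[OF _ m I])
    fix h assume "h \<in> I"
    then have "h @ [dot d (loss (Suc t)) x] \<in> ?J" if "x \<in> S" for x
      using that by (intro image_eqI[where x = "(h, x)"]) auto
    then have "(\<lambda>x. h @ [dot d (loss (Suc t)) x]) \<in> measurable (count_space S) (count_space ?J)"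
      by simp
    from measurable_compose[OF A this]
    show "(\<lambda>\<omega>. h @ [dot d (loss (Suc t)) (A \<omega> h)]) \<in> measurable M (count_space ?J)" .
  qed
  moreover have "countable ?J"
    using I S by auto
  ultimately show ?case
    by (intro exI[of _ ?J]) simp
qed

lemma borel_measurable_total_loss:
  assumes S: "countable S" and A: "\<And>h. (\<lambda>\<omega>. A \<omega> h) \<in> measurable M (count_space S)"
  shows "(\<lambda>\<omega>. total_loss d T (A \<omega>) loss) \<in> borel_measurable M"
proof -
  have "(\<lambda>\<omega>. dot d (loss t) (action d (A \<omega>) loss t)) \<in> borel_measurable M" for t
  proof -
    have "\<exists>I. countable I \<and>
        (\<lambda>\<omega>. observations d (A \<omega>) loss (t - 1)) \<in> measurable M (count_space I)"
      by (rule measurable_observations[OF S A])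
    then obtain I where I: "countable I"
      and m: "(\<lambda>\<omega>. observations d (A \<omega>) loss (t - 1)) \<in> measurable M (count_space I)"
      by (elim exE conjE)
    have "(\<lambda>\<omega>. dot d (loss t) (A \<omega> h)) \<in> borel_measurable M" for h
      using measurable_compose[OF A[of h], where g = "dot d (loss t)"] by simp
    from measurable_compose_countable'[where f = "\<lambda>h \<omega>. dot d (loss t) (A \<omega> h)", OF this m I]
    show ?thesis
      unfolding action_def .
  qed
  then show ?thesis
    unfolding total_loss_def by (intro borel_measurable_sum)
qed

lemma measurable_seed:
  assumes A: "\<And>h. (\<lambda>\<omega>. A \<omega> h) \<in> measurable M (count_space S)"
  shows "A \<in> measurable M (\<Pi>\<^sub>M h\<in>UNIV. count_space S)"
proof (rule measurable_PiM_single')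
  show "(\<lambda>\<omega> h. A \<omega> h) \<in> space M \<rightarrow> (\<Pi>\<^sub>E h\<in>UNIV. space (count_space S))"
    using measurable_space[OF A] by (auto simp: PiE_def)
qed (rule A)

lemma randomized_algorithm_of_seed:
  assumes "prob_space M" and A: "\<And>h. (\<lambda>\<omega>. A \<omega> h) \<in> measurable M (count_space S)"
  shows "randomized_algorithm S (distr M (\<Pi>\<^sub>M h\<in>UNIV. count_space S) A)"
  unfolding randomized_algorithm_def
proof (intro conjI allI)
  show "prob_space (distr M (\<Pi>\<^sub>M h\<in>UNIV. count_space S) A)"
    by (rule prob_space.prob_space_distr[OF assms(1) measurable_seed[OF A]])
  show "(\<lambda>A. A h) \<in> measurable (distr M (\<Pi>\<^sub>M h\<in>UNIV. count_space S) A) (count_space S)" for h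
    unfolding measurable_distr_eq1 by (rule measurable_component_singleton) simp
qed

lemma expected_regret_of_seed:
  assumes S: "countable S" and A: "\<And>h. (\<lambda>\<omega>. A \<omega> h) \<in> measurable M (count_space S)"
  shows "expected_regret d S T (distr M (\<Pi>\<^sub>M h\<in>UNIV. count_space S) A) loss =
    (\<integral>\<omega>. total_loss d T (A \<omega>) loss \<partial>M) - (MIN x\<in>S. \<Sum>t = 1..T. dot d (loss t) x)"
proof -
  have "(\<lambda>A. total_loss d T A loss) \<in> borel_measurable (\<Pi>\<^sub>M h\<in>UNIV. count_space S)"
    by (rule borel_measurable_total_loss[OF S]) (auto intro: measurable_component_singleton)
  then show ?thesis
    unfolding expected_regret_def by (simp add: integral_distr measurable_seed[OF A])
qed

end

theory Submission
  imports Defs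
begin

text \<open>
  Fix a hidden arm \<open>a j\<close> in every task \<open>j\<close>. In each round all coordinates of the loss are shifted by
  the same random amount \<open>w / (4 N)\<close>, and with probability \<open>1/2\<close> the hidden arms are cheaper by
  \<open>k / (4 N)\<close>. Up to rescaling the learner then observes \<open>w - b m\<close>, where \<open>m\<close> is the number of hidden
  arms chosen and \<open>b\<close> is a fair coin. If \<open>w\<close> has mass proportional to \<open>(N + 1 - \<bar>w\<bar>)\<^sup>2\<close>, changing
  \<open>m\<close> by one costs only \<open>O(1 / N\<^sup>2)\<close> in relative entropy. Compare with the environment in which task
  \<open>j\<close> has no cheap arm: there the pulls of the \<open>n\<close> arms of task \<open>j\<close> sum to \<open>T\<close>, so with \<open>N\<close> of order
  \<open>sqrt (T / n)\<close> the hidden arm, averaged over its position, is found in at most \<open>3/4\<close> of the rounds.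
  Hence the average regret is of order \<open>k (k / N) T\<close>, which is \<open>k powr (3/2) * sqrt (d T)\<close>. Bounded noise
  makes clipping superfluous, so no logarithm is lost.
\<close>

section \<open>Relative entropy of adaptively generated sequences\<close>

definition seqs :: "'a set \<Rightarrow> nat \<Rightarrow> 'a list set" where
  "seqs Y t = {h. set h \<subseteq> Y \<and> length h = t}"

text \<open>Law of a history when \<open>q h\<close> is the conditional distribution of the next
  symbol after \<open>h\<close>.\<close>

definition path_prob :: "('a list \<Rightarrow> 'a \<Rightarrow> real) \<Rightarrow> 'a list \<Rightarrow> real" where
  "path_prob q h = (\<Prod>t<length h. q (take t h) (h ! t))"

lemma seqs_0 [simp]: "seqs Y 0 = {[]}"
  by (auto simp: seqs_def)

lemma finite_seqs [simp]: "finite Y \<Longrightarrow> finite (seqs Y t)"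
  unfolding seqs_def by (rule finite_lists_length_eq)

lemma sum_seqs_Suc: "sum f (seqs Y (Suc t)) = (\<Sum>h\<in>seqs Y t. \<Sum>y\<in>Y. f (h @ [y]))"
proof -
  have "seqs Y (Suc t) = (\<lambda>(h, y). h @ [y]) ` (seqs Y t \<times> Y)"
  proof (intro equalityI subsetI)
    fix h assume "h \<in> seqs Y (Suc t)"
    then show "h \<in> (\<lambda>(h, y). h @ [y]) ` (seqs Y t \<times> Y)"
      by (cases h rule: rev_cases) (force simp: seqs_def)+
  qed (auto simp: seqs_def)
  moreover have "inj_on (\<lambda>(h, y). h @ [y]) (seqs Y t \<times> Y)"
    by (auto simp: inj_on_def)
  ultimately show ?thesis
    by (simp add: sum.reindex sum.cartesian_product case_prod_unfold)
qed

lemma path_prob_Nil [simp]: "path_prob q [] = 1"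
  by (simp add: path_prob_def)

lemma path_prob_snoc [simp]: "path_prob q (h @ [y]) = path_prob q h * q h y"
  by (simp add: path_prob_def nth_append)

lemma path_prob_nonneg: "(\<And>h y. q h y \<ge> 0) \<Longrightarrow> path_prob q h \<ge> 0"
  by (simp add: path_prob_def prod_nonneg)

lemma path_prob_step_nonzero:
  "path_prob q h \<noteq> 0 \<Longrightarrow> t < length h \<Longrightarrow> q (take t h) (h ! t) \<noteq> 0"
  by (simp add: path_prob_def)

text \<open>The finite alphabet turns every expectation over the environment into a finite sum, so
  integrals occur only for the learner's own randomness.\<close>

locale kernel =
  fixes Y :: "'a set" and q :: "'a list \<Rightarrow> 'a \<Rightarrow> real"
  assumes finite_Y [simp]: "finite Y"
    and nonneg: "q h y \<ge> 0"
    and sum_1: "(\<Sum>y\<in>Y. q h y) = 1"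
begin

definition expect :: "nat \<Rightarrow> ('a list \<Rightarrow> real) \<Rightarrow> real" where
  "expect t F = (\<Sum>h\<in>seqs Y t. path_prob q h * F h)"

lemma expect_0 [simp]: "expect 0 F = F []"
  by (simp add: expect_def)

lemma expect_Suc: "expect (Suc t) F = expect t (\<lambda>h. \<Sum>y\<in>Y. q h y * F (h @ [y]))"
  by (simp add: expect_def sum_seqs_Suc sum_distrib_left mult.assoc)

lemma expect_const: "expect t (\<lambda>h. c) = c"
  by (induction t) (simp_all add: expect_Suc sum_1 flip: sum_distrib_right)

lemma expect_mono: "(\<And>h. h \<in> seqs Y t \<Longrightarrow> F h \<le> G h) \<Longrightarrow> expect t F \<le> expect t G"
  unfolding expect_def by (intro sum_mono mult_left_mono path_prob_nonneg nonneg)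

lemma expect_add: "expect t (\<lambda>h. F h + G h) = expect t F + expect t G"
  by (simp add: expect_def ring_distribs sum.distrib)

lemma expect_cmult: "expect t (\<lambda>h. c * F h) = c * expect t F"
  by (simp add: expect_def sum_distrib_left mult_ac)

lemma expect_cong: "(\<And>h. h \<in> seqs Y t \<Longrightarrow> F h = G h) \<Longrightarrow> expect t F = expect t G"
  unfolding expect_def by (intro sum.cong) auto

lemma expect_sum: "expect t (\<lambda>h. \<Sum>i\<in>I. F i h) = (\<Sum>i\<in>I. expect t (F i))"
  unfolding expect_def sum_distrib_left by (rule sum.swap)

text \<open>Tower property: each summand may be replaced by its conditional expectation given the
  preceding history.\<close>

lemma expect_additive:
  "expect T (\<lambda>h. \<Sum>t<T. f (take t h) (h ! t)) =
   expect T (\<lambda>h. \<Sum>t<T. \<Sum>y\<in>Y. q (take t h) y * f (take t h) y)"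
proof (induction T)
  case (Suc T)
  have A: "expect (Suc T) (\<lambda>h. \<Sum>t<Suc T. g (take t h) (h ! t)) =
     expect T (\<lambda>h. \<Sum>t<T. g (take t h) (h ! t)) + expect T (\<lambda>h. \<Sum>y\<in>Y. q h y * g h y)" for g
  proof -
    have "(\<Sum>t<Suc T. g (take t (h @ [y])) ((h @ [y]) ! t)) = (\<Sum>t<T. g (take t h) (h ! t)) + g h y"
      if "h \<in> seqs Y T" for h y
      using that by (simp add: seqs_def nth_append)
    then have "expect (Suc T) (\<lambda>h. \<Sum>t<Suc T. g (take t h) (h ! t)) =
       expect T (\<lambda>h. \<Sum>y\<in>Y. q h y * ((\<Sum>t<T. g (take t h) (h ! t)) + g h y))"
      unfolding expect_Suc by (intro expect_cong) simp
    also have "\<dots> = expect T (\<lambda>h. (\<Sum>t<T. g (take t h) (h ! t)) + (\<Sum>y\<in>Y. q h y * g h y))"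
      by (simp add: ring_distribs sum.distrib sum_1 flip: sum_distrib_right)
    finally show ?thesis
      by (simp add: expect_add)
  qed
  show ?case
    \<comment> \<open>The right-hand side is again of the form treated in \<open>A\<close>, with a
      summand that ignores its last symbol.\<close>
    using Suc A[of f] A[of "\<lambda>h _. \<Sum>y\<in>Y. q h y * f h y"]
    by (simp add: sum_1 flip: sum_distrib_right)
qed simp

end

section \<open>Hellinger distance, relative entropy and chi-square divergence\<close>

text \<open>This is \<open>ln x \<le> x - 1\<close> at \<open>x = sqrt (q / p)\<close>. The
  correction \<open>- p + q\<close> disappears when summed over two probability vectors.\<close>

lemma hellinger_le_entropy_term:
  fixes p q :: real
  assumes "p \<ge> 0" "q \<ge> 0" "p > 0 \<Longrightarrow> q > 0"
  shows "(sqrt p - sqrt q)\<^sup>2 \<le> p * ln (p / q) - p + q"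
proof (cases "p = 0")
  case False
  with assms have pq: "p > 0" "q > 0" by auto
  have "ln (sqrt (q / p)) \<le> sqrt (q / p) - 1"
    using pq by (intro ln_le_minus_one) simp
  then have "ln q - ln p \<le> 2 * (sqrt (q / p) - 1)"
    using pq by (simp add: ln_sqrt ln_div)
  then have "p * (ln q - ln p) \<le> p * (2 * (sqrt (q / p) - 1))"
    using pq by (intro mult_left_mono) auto
  moreover have "p * sqrt (q / p) = sqrt p * sqrt q"
    using pq by (simp add: real_sqrt_divide field_simps)
  ultimately have "p * (ln q - ln p) \<le> 2 * (sqrt p * sqrt q) - 2 * p"
    by (simp add: algebra_simps)
  moreover have "p * ln (p / q) = - (p * (ln q - ln p))"
    using pq by (simp add: ln_div algebra_simps)
  moreover have "(sqrt p - sqrt q)\<^sup>2 = p + q - 2 * (sqrt p * sqrt q)"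
    using pq by (simp add: power2_diff)
  ultimately show ?thesis by linarith
qed (use assms in auto)

text \<open>A Pinsker-type inequality: factor \<open>p - q\<close> as a difference of squares of
  square roots and apply Cauchy-Schwarz. The first factor is the Hellinger distance, the second is
  at most \<open>sqrt 4\<close>.\<close>

lemma l1_le_sqrt_entropy:
  fixes p q :: "'a \<Rightarrow> real"
  assumes p: "\<And>x. x \<in> I \<Longrightarrow> p x \<ge> 0" "sum p I = 1"
    and q: "\<And>x. x \<in> I \<Longrightarrow> q x \<ge> 0" "sum q I = 1"
    and ac: "\<And>x. x \<in> I \<Longrightarrow> p x > 0 \<Longrightarrow> q x > 0"
  shows "(\<Sum>x\<in>I. \<bar>p x - q x\<bar>) \<le> 2 * sqrt (\<Sum>x\<in>I. p x * ln (p x / q x))"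
proof -
  let ?a = "\<lambda>x. \<bar>sqrt (p x) - sqrt (q x)\<bar>" and ?b = "\<lambda>x. sqrt (p x) + sqrt (q x)"
  have "(\<Sum>x\<in>I. \<bar>p x - q x\<bar>) = (\<Sum>x\<in>I. ?a x * ?b x)"
  proof (rule sum.cong)
    fix x assume x: "x \<in> I"
    have "p x - q x = (sqrt (p x) - sqrt (q x)) * ?b x"
      using p(1)[OF x] q(1)[OF x] by (simp add: algebra_simps)
    then show "\<bar>p x - q x\<bar> = ?a x * ?b x"
      using p(1)[OF x] q(1)[OF x] by (simp add: abs_mult)
  qed simp
  also have "\<dots> \<le> sqrt (\<Sum>x\<in>I. (?a x)\<^sup>2) * sqrt (\<Sum>x\<in>I. (?b x)\<^sup>2)"
    using L2_set_mult_ineq[of ?a ?b I] by (simp add: L2_set_def abs_mult add_nonneg_nonneg p q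
        abs_of_nonneg cong: sum.cong)
  also have "\<dots> \<le> sqrt (\<Sum>x\<in>I. p x * ln (p x / q x)) * sqrt 4"
  proof (intro mult_mono real_sqrt_le_mono)
    have "(\<Sum>x\<in>I. (?a x)\<^sup>2) \<le> (\<Sum>x\<in>I. p x * ln (p x / q x) - p x + q x)"
      using hellinger_le_entropy_term p(1) q(1) ac by (intro sum_mono) simp
    then show "(\<Sum>x\<in>I. (?a x)\<^sup>2) \<le> (\<Sum>x\<in>I. p x * ln (p x / q x))"
      by (simp add: sum.distrib sum_subtractf p q)
    have "(\<Sum>x\<in>I. (?b x)\<^sup>2) \<le> (\<Sum>x\<in>I. 2 * p x + 2 * q x)"
    proof (rule sum_mono)
      fix x assume x: "x \<in> I"
      have "(?b x)\<^sup>2 + (sqrt (p x) - sqrt (q x))\<^sup>2 = 2 * p x + 2 * q x"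
        using p(1)[OF x] q(1)[OF x] by (simp add: power2_sum power2_diff)
      then show "(?b x)\<^sup>2 \<le> 2 * p x + 2 * q x"
        using zero_le_power2[of "sqrt (p x) - sqrt (q x)"] by linarith
    qed
    also have "\<dots> = 4"
      by (simp add: sum.distrib p q flip: sum_distrib_left)
    finally show "(\<Sum>x\<in>I. (?b x)\<^sup>2) \<le> 4" .
    show "0 \<le> sqrt (\<Sum>x\<in>I. p x * ln (p x / q x))"
      using sum_nonneg[of I "\<lambda>x. (?a x)\<^sup>2"]
        \<open>(\<Sum>x\<in>I. (?a x)\<^sup>2) \<le> (\<Sum>x\<in>I. p x * ln (p x / q x))\<close> by simp
  qed (simp add: sum_nonneg)
  finally show ?thesis by simp
qed

text \<open>Again \<open>ln x \<le> x - 1\<close>, now at \<open>x = p / q\<close>; the linear terms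
  cancel in the sum.\<close>

lemma entropy_le_chi_square:
  fixes p q :: "'a \<Rightarrow> real"
  assumes p: "\<And>x. x \<in> I \<Longrightarrow> p x \<ge> 0" "sum p I = 1"
    and q: "\<And>x. x \<in> I \<Longrightarrow> q x \<ge> 0" "sum q I = 1"
    and ac: "\<And>x. x \<in> I \<Longrightarrow> p x > 0 \<Longrightarrow> q x > 0"
  shows "(\<Sum>x\<in>I. p x * ln (p x / q x)) \<le> (\<Sum>x\<in>I. (p x - q x)\<^sup>2 / q x)"
proof -
  have "(\<Sum>x\<in>I. p x * ln (p x / q x)) \<le> (\<Sum>x\<in>I. (p x - q x)\<^sup>2 / q x + p x - q x)"
  proof (rule sum_mono)
    fix x assume x: "x \<in> I"
    show "p x * ln (p x / q x) \<le> (p x - q x)\<^sup>2 / q x + p x - q x"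
    proof (cases "p x > 0")
      case True
      then have "p x * ln (p x / q x) \<le> p x * (p x / q x - 1)"
        using ac[OF x] by (intro mult_left_mono ln_le_minus_one) auto
      also have "\<dots> = (p x - q x)\<^sup>2 / q x + p x - q x"
        using ac[OF x True] by (simp add: field_simps power2_eq_square)
      finally show ?thesis .
    next
      case False
      then have "p x = 0" using p(1)[OF x] by simp
      then show ?thesis by (simp add: power2_eq_square)
    qed
  qed
  also have "\<dots> = (\<Sum>x\<in>I. (p x - q x)\<^sup>2 / q x)"
    by (simp add: sum.distrib sum_subtractf p q)
  finally show ?thesis .
qed

text \<open>The chain rule splits the relative entropy of the two history laws into one-step
  entropies. They are averaged under \<open>p\<close>, the reference environment, so the price of
  passing to \<open>q\<close> can be measured by what the learner does under
  \<open>p\<close>.\<close>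

lemma change_of_measure:
  assumes P: "kernel Y p" and Q: "kernel Y q"
    and ac: "\<And>h y. p h y > 0 \<Longrightarrow> q h y > 0"
    and D: "\<And>h. (\<Sum>y\<in>Y. p h y * ln (p h y / q h y)) \<le> D h"
    and f: "\<And>h. h \<in> seqs Y T \<Longrightarrow> 0 \<le> f h \<and> f h \<le> B"
  shows "kernel.expect Y q T f \<le>
    kernel.expect Y p T f + 2 * B * sqrt (kernel.expect Y p T (\<lambda>h. \<Sum>t<T. D (take t h)))"
proof -
  interpret P: kernel Y p by fact
  interpret Q: kernel Y q by fact
  let ?I = "seqs Y T"
  have pp_ac: "path_prob q h > 0" if "path_prob p h > 0" for h
    unfolding path_prob_def
  proof (intro prod_pos ac)
    fix t assume "t \<in> {..<length h}"
    then have "p (take t h) (h ! t) \<noteq> 0"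
      using that path_prob_step_nonzero[of p h t] by simp
    then show "p (take t h) (h ! t) > 0"
      using P.nonneg[of "take t h" "h ! t"] by simp
  qed
  \<comment> \<open>The logarithm of a product of likelihood ratios; the weight
    \<open>path_prob p h\<close> makes histories of probability zero harmless.\<close>
  have chain: "path_prob p h * ln (path_prob p h / path_prob q h) =
      path_prob p h * (\<Sum>t<T. ln (p (take t h) (h ! t) / q (take t h) (h ! t)))"
    if h: "h \<in> ?I" for h
  proof (cases "path_prob p h = 0")
    case False
    have pos: "p (take t h) (h ! t) > 0" if "t < length h" for t
      using path_prob_step_nonzero[OF False that] P.nonneg[of "take t h" "h ! t"] by simp
    have "ln (path_prob p h / path_prob q h) =
      ln (\<Prod>t<T. p (take t h) (h ! t) / q (take t h) (h ! t))"
      using h by (simp add: path_prob_def seqs_def prod_dividef)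
    also have "\<dots> = (\<Sum>t<T. ln (p (take t h) (h ! t) / q (take t h) (h ! t)))"
    proof (rule ln_prod)
      fix t assume "t \<in> {..<T}"
      then have "p (take t h) (h ! t) > 0"
        using h by (intro pos) (simp add: seqs_def)
      then show "p (take t h) (h ! t) / q (take t h) (h ! t) \<noteq> 0"
        using ac[of "take t h" "h ! t"] by simp
    qed simp
    finally show ?thesis by simp
  qed simp
  have "B \<ge> 0"
  proof (cases "?I = {}")
    case True
    then have "P.expect T (\<lambda>_. 1) = 0" by (simp add: P.expect_def)
    then show ?thesis using P.expect_const[of T 1] by simp
  next
    case False
    then show ?thesis using f by (force intro: order_trans)
  qed
  have "Q.expect T f - P.expect T f = (\<Sum>h\<in>?I. (path_prob q h - path_prob p h) * f h)"
    by (simp add: P.expect_def Q.expect_def left_diff_distrib sum_subtractf)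
  also have "\<dots> \<le> (\<Sum>h\<in>?I. \<bar>path_prob p h - path_prob q h\<bar> * B)"
  proof (rule sum_mono)
    fix h assume h: "h \<in> ?I"
    have "(path_prob q h - path_prob p h) * f h \<le> \<bar>path_prob p h - path_prob q h\<bar> * f h"
      using f[OF h] by (intro mult_right_mono) auto
    also have "\<dots> \<le> \<bar>path_prob p h - path_prob q h\<bar> * B"
      using f[OF h] by (intro mult_left_mono) auto
    finally show "(path_prob q h - path_prob p h) * f h \<le> \<bar>path_prob p h - path_prob q h\<bar> * B" .
  qed
  also have "\<dots> = (\<Sum>h\<in>?I. \<bar>path_prob p h - path_prob q h\<bar>) * B"
    by (simp add: sum_distrib_right)
  also have "\<dots> \<le> 2 * sqrt (\<Sum>h\<in>?I. path_prob p h * ln (path_prob p h / path_prob q h)) * B"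
    using \<open>B \<ge> 0\<close> P.expect_const[of T 1] Q.expect_const[of T 1]
    by (intro mult_right_mono l1_le_sqrt_entropy path_prob_nonneg P.nonneg Q.nonneg pp_ac)
      (simp_all add: P.expect_def Q.expect_def)
  also have "(\<Sum>h\<in>?I. path_prob p h * ln (path_prob p h / path_prob q h)) =
      P.expect T (\<lambda>h. \<Sum>t<T. ln (p (take t h) (h ! t) / q (take t h) (h ! t)))"
    unfolding P.expect_def using chain by (intro sum.cong) auto
  also have "\<dots> = P.expect T (\<lambda>h. \<Sum>t<T. \<Sum>y\<in>Y. p (take t h) y * ln (p (take t h) y / q (take t h) y))"
    by (rule P.expect_additive)
  also have "2 * sqrt \<dots> * B \<le> 2 * sqrt (P.expect T (\<lambda>h. \<Sum>t<T. D (take t h))) * B"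
    using \<open>B \<ge> 0\<close> by (intro mult_right_mono mult_left_mono real_sqrt_le_mono P.expect_mono sum_mono D) auto
  finally show ?thesis by (simp add: mult_ac)
qed

section \<open>The feedback distribution\<close>

text \<open>The noise is the square of this 1-Lipschitz function. For a density \<open>u^2\<close>
  the Fisher information density is \<open>4 u'^2\<close>, so it is bounded even where
  \<open>u\<close> tends to zero; this is the discrete counterpart.\<close>

definition tent :: "nat \<Rightarrow> int \<Rightarrow> real" where
  "tent N w = max 0 (real N + 1 - \<bar>real_of_int w\<bar>)"

definition tent_mass :: "nat \<Rightarrow> real" where
  "tent_mass N = (\<Sum>w = - int N..int N. (tent N w)\<^sup>2)"

definition noise :: "nat \<Rightarrow> int \<Rightarrow> real" where
  "noise N w = (tent N w)\<^sup>2 / tent_mass N"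

text \<open>The law of \<open>w - b m\<close> for \<open>w\<close> drawn from \<open>noise N\<close>
  and a fair coin \<open>b\<close>: an outcome \<open>y\<close> with \<open>b = 1\<close> comes from
  \<open>w = y + m\<close>.\<close>

definition feedback :: "nat \<Rightarrow> nat \<Rightarrow> int \<Rightarrow> real" where
  "feedback N m y = (noise N y + noise N (y + int m)) / 2"

text \<open>Half of the support suffices: at \<open>w = N - j\<close> the tent has height
  \<open>j + 1\<close>, and the sum of the squares \<open>j^2\<close> is at least
  \<open>N^3 / 3\<close>.\<close>

lemma tent_mass_ge: "tent_mass N \<ge> real N ^ 3 / 3"
proof -
  have sq: "(\<Sum>j\<le>n. real j ^ 2) \<ge> real n ^ 3 / 3" for n
    by (induction n) (auto simp: power3_eq_cube power2_eq_square algebra_simps)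
  have "(\<Sum>j\<le>N. real j ^ 2) \<le> (\<Sum>j\<le>N. (tent N (int N - int j))\<^sup>2)"
    by (intro sum_mono power_mono) (auto simp: tent_def)
  also have "\<dots> = (\<Sum>w\<in>(\<lambda>j. int N - int j) ` {..N}. (tent N w)\<^sup>2)"
    by (subst sum.reindex) (auto simp: inj_on_def)
  also have "\<dots> \<le> tent_mass N"
    unfolding tent_mass_def by (intro sum_mono2) auto
  finally show ?thesis using sq[of N] by linarith
qed

lemma tent_mass_pos: "N > 0 \<Longrightarrow> tent_mass N > 0"
  using tent_mass_ge[of N] by (smt (verit) divide_pos_pos of_nat_0_less_iff zero_less_power)

lemma tent_pos_iff: "tent N w > 0 \<longleftrightarrow> w \<in> {- int N..int N}"
proof -
  have "real N + 1 - \<bar>real_of_int w\<bar> = real_of_int (int N + 1 - \<bar>w\<bar>)" by simp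
  then have "tent N w > 0 \<longleftrightarrow> real_of_int (int N + 1 - \<bar>w\<bar>) > 0"
    unfolding tent_def by linarith
  then show ?thesis by (simp only: of_int_0_less_iff) auto
qed

lemma tent_nonneg: "tent N w \<ge> 0"
  by (simp add: tent_def)

lemma tent_ge_1: "w \<in> {- int N..int N} \<Longrightarrow> tent N w \<ge> 1"
proof -
  assume "w \<in> {- int N..int N}"
  then have "\<bar>real_of_int w\<bar> \<le> real N" by auto
  then show ?thesis by (simp add: tent_def)
qed

lemma tent_eq_0: "w \<notin> {- int N..int N} \<Longrightarrow> tent N w = 0"
  using tent_pos_iff[of N w] tent_nonneg[of N w] by linarith

lemma tent_lipschitz: "\<bar>tent N w - tent N (w + 1)\<bar> \<le> 1"
  unfolding tent_def of_int_add of_int_1 by linarith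

lemma noise_nonneg: "noise N w \<ge> 0"
  by (simp add: noise_def tent_mass_def sum_nonneg)

lemma noise_pos_iff: "N > 0 \<Longrightarrow> noise N w > 0 \<longleftrightarrow> w \<in> {- int N..int N}"
  using tent_mass_pos[of N] tent_pos_iff[of N w] tent_nonneg[of N w]
  by (auto simp: noise_def zero_less_divide_iff)

lemma noise_eq_0: "w \<notin> {- int N..int N} \<Longrightarrow> noise N w = 0"
  by (simp add: noise_def tent_eq_0)

lemma sum_noise: "N > 0 \<Longrightarrow> (\<Sum>w = - int N..int N. noise N w) = 1"
  using tent_mass_pos[of N] unfolding noise_def sum_divide_distrib[symmetric]
  by (simp add: tent_mass_def[symmetric])

lemma mean_noise: "(\<Sum>w = - int N..int N. noise N w * real_of_int w) = 0"
proof -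
  have "(\<Sum>w = - int N..int N. noise N w * real_of_int w) =
      (\<Sum>w = - int N..int N. noise N (- w) * real_of_int (- w))"
    by (rule sum.reindex_bij_witness[of _ uminus uminus]) auto
  also have "\<dots> = - (\<Sum>w = - int N..int N. noise N w * real_of_int w)"
    by (simp add: noise_def tent_def sum_negf)
  finally show ?thesis by simp
qed

text \<open>The window from \<open>- N - k\<close> to \<open>N\<close> contains every outcome
  \<open>w - m\<close> with \<open>m \<le> k\<close>, so all environments share one
  alphabet.\<close>

lemma sum_noise_shift:
  assumes "m \<le> k"
  shows "(\<Sum>y = - int N - int k..int N. noise N (y + int m) * G y) =
    (\<Sum>w = - int N..int N. noise N w * G (w - int m))"
proof -
  have "(\<Sum>w = - int N..int N. noise N w * G (w - int m)) =
      (\<Sum>y = - int N - int m..int N - int m. noise N (y + int m) * G y)"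
    by (rule sum.reindex_bij_witness[of _ "\<lambda>y. y + int m" "\<lambda>w. w - int m"]) auto
  also have "\<dots> = (\<Sum>y = - int N - int k..int N. noise N (y + int m) * G y)"
    using assms by (intro sum.mono_neutral_left) (auto intro!: noise_eq_0)
  finally show ?thesis by simp
qed

lemma sum_feedback:
  assumes "m \<le> k"
  shows "(\<Sum>y = - int N - int k..int N. feedback N m y * G y) =
    (\<Sum>w = - int N..int N. noise N w / 2 * G w + noise N w / 2 * G (w - int m))"
  using sum_noise_shift[OF assms, of N "\<lambda>y. G y / 2"] sum_noise_shift[of 0 k N "\<lambda>y. G y / 2"]
  by (simp add: feedback_def sum.distrib add_divide_distrib ring_distribs)

lemma feedback_nonneg: "feedback N m y \<ge> 0"
  by (simp add: feedback_def noise_nonneg)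

lemma sum_feedback_1:
  assumes "m \<le> k" "N > 0"
  shows "(\<Sum>y = - int N - int k..int N. feedback N m y) = 1"
  using sum_feedback[OF assms(1), of N "\<lambda>_. 1"] sum_noise[OF assms(2)]
  by (simp add: sum.distrib flip: sum_divide_distrib)

lemma mean_feedback:
  assumes "m \<le> k" "N > 0"
  shows "(\<Sum>y = - int N - int k..int N. feedback N m y * real_of_int y) = - real m / 2"
proof -
  have "(\<Sum>y = - int N - int k..int N. feedback N m y * real_of_int y) =
    (\<Sum>w = - int N..int N. noise N w * real_of_int w - (real m / 2) * noise N w)"
    unfolding sum_feedback[OF assms(1)] by (intro sum.cong) (auto simp: field_simps)
  also have "\<dots> = - real m / 2"
    using mean_noise[of N] sum_noise[OF assms(2)]
    by (simp add: sum_subtractf del: times_divide_eq_left flip: sum_distrib_left)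
  finally show ?thesis .
qed

section \<open>Cost of one additional match in relative entropy\<close>

text \<open>Only \<open>y + m = N\<close> leaves the support of the shifted noise when
  \<open>m\<close> grows by one. Then \<open>y = N - m\<close> lies in the support of the unshifted
  noise, because \<open>m \<le> 2 * N\<close>.\<close>

lemma feedback_pos_Suc:
  assumes "N > 0" "m \<le> 2 * N" "feedback N m y > 0"
  shows "feedback N (Suc m) y > 0"
proof -
  have "noise N y > 0 \<or> noise N (y + int m) > 0"
    using assms(3) noise_nonneg[of N y] noise_nonneg[of N "y + int m"]
    unfolding feedback_def by auto
  then have "noise N y > 0 \<or> noise N (y + int (Suc m)) > 0"
    using assms(1,2) by (auto simp: noise_pos_iff)
  then show ?thesis
    by (auto simp: feedback_def noise_nonneg intro: add_pos_nonneg add_nonneg_pos)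
qed

text \<open>
  The fair coin that switches the signal off keeps \<open>feedback N (Suc m)\<close> positive at the upper end
  of the support of \<open>feedback N m\<close>, so the chi-square divergence stays finite there.
\<close>

lemma feedback_chi_square_term:
  assumes N: "N > 0" and m: "m \<le> 2 * N"
  shows "(feedback N m y - feedback N (Suc m) y)\<^sup>2 / feedback N (Suc m) y \<le> 9 / (2 * tent_mass N)"
proof -
  define Z where "Z = tent_mass N"
  define r where "r = tent N (y + int m)"
  define r' where "r' = tent N (y + int m + 1)"
  define s where "s = tent N y"
  have Z: "Z > 0" using tent_mass_pos[OF N] by (simp add: Z_def)
  have nn: "r \<ge> 0" "r' \<ge> 0" "s \<ge> 0" by (simp_all add: r_def r'_def s_def tent_nonneg)
  have lip: "\<bar>r - r'\<bar> \<le> 1" using tent_lipschitz[of N "y + int m"] by (simp add: r_def r'_def)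
  \<comment> \<open>For \<open>v = 0\<close> both sides are 0 by the convention for division by
    zero.\<close>
  have quotient: "(u / c)\<^sup>2 / (v / c) = u\<^sup>2 / v / c" if "c > 0" for u v c :: real
    using that by (cases "v = 0") (simp_all add: power2_eq_square)
  have "(feedback N m y - feedback N (Suc m) y)\<^sup>2 / feedback N (Suc m) y =
     ((r\<^sup>2 - r'\<^sup>2) / (2 * Z))\<^sup>2 / ((s\<^sup>2 + r'\<^sup>2) / (2 * Z))"
    by (simp add: feedback_def noise_def r_def r'_def s_def Z_def mult.commute add_ac
        diff_divide_distrib add_divide_distrib)
  also have "\<dots> = (r\<^sup>2 - r'\<^sup>2)\<^sup>2 / (s\<^sup>2 + r'\<^sup>2) / (2 * Z)"
    using Z by (intro quotient) simp
  also have "\<dots> \<le> 9 / (2 * Z)"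
  proof -
    have eq: "(r\<^sup>2 - r'\<^sup>2)\<^sup>2 = (r - r')\<^sup>2 * (r + r')\<^sup>2"
      by (simp add: power2_eq_square algebra_simps)
    have d1: "(r - r')\<^sup>2 \<le> 1"
      using lip by (simp add: abs_square_le_1)
    have "(r\<^sup>2 - r'\<^sup>2)\<^sup>2 / (s\<^sup>2 + r'\<^sup>2) \<le> 9"
    \<comment> \<open>In the interior \<open>r' \<ge> 1\<close> absorbs the Lipschitz error:
      \<open>r \<le> r' + 1 \<le> 2 * r'\<close>, hence \<open>r + r' \<le> 3 * r'\<close>, which
      gives the 9.\<close>
    proof (cases "y + int m + 1 \<in> {- int N..int N}")
      case True
      then have r': "r' \<ge> 1" using tent_ge_1 by (simp add: r'_def)
      then have "r + r' \<le> 3 * r'" using lip by linarith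
      then have "(r + r')\<^sup>2 \<le> (3 * r')\<^sup>2" using nn by (intro power_mono) auto
      then have "(r - r')\<^sup>2 * (r + r')\<^sup>2 \<le> 1 * (9 * r'\<^sup>2)"
        using d1 by (intro mult_mono) (auto simp: power_mult_distrib)
      also have "\<dots> \<le> 9 * (s\<^sup>2 + r'\<^sup>2)" by simp
      finally show ?thesis
        using r' by (simp add: eq divide_le_eq add_nonneg_pos)
    next
      case False
      then have r': "r' = 0" by (simp add: r'_def tent_eq_0)
      show ?thesis
      \<comment> \<open>Here \<open>y + m = N\<close>: the numerator is at most 1 and the unshifted
        part \<open>s\<close> alone keeps the denominator at least 1.\<close>
      proof (cases "y + int m \<in> {- int N..int N}")
        case True
        with False m have "y \<in> {- int N..int N}" by auto
        then have "s \<ge> 1" using tent_ge_1 by (simp add: s_def)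
        then have s2: "s\<^sup>2 \<ge> 1" by simp
        have "r \<le> 1" using lip r' nn by linarith
        then have "(r\<^sup>2)\<^sup>2 \<le> 1" using nn by (simp add: power_le_one)
        then have "(r\<^sup>2)\<^sup>2 \<le> 9 * s\<^sup>2" using s2 by linarith
        then show ?thesis using s2 r' by (simp add: divide_le_eq)
      next
        case False
        then have "r = 0" by (simp add: r_def tent_eq_0)
        then show ?thesis by (simp add: r')
      qed
    qed
    then show ?thesis
      using Z by (intro divide_right_mono) auto
  qed
  finally show ?thesis by (simp add: Z_def)
qed

lemma feedback_entropy:
  assumes N: "N > 0" and k: "k \<le> N" and m: "Suc m \<le> k"
  shows "(\<Sum>y = - int N - int k..int N. feedback N m y * ln (feedback N m y / feedback N (Suc m) y))
     \<le> 54 / (real N)\<^sup>2"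
proof -
  let ?Y = "{- int N - int k..int N}"
  have "(\<Sum>y\<in>?Y. feedback N m y * ln (feedback N m y / feedback N (Suc m) y)) \<le>
      (\<Sum>y\<in>?Y. (feedback N m y - feedback N (Suc m) y)\<^sup>2 / feedback N (Suc m) y)"
    using N k m
    by (intro entropy_le_chi_square feedback_nonneg sum_feedback_1 feedback_pos_Suc) auto
  also have "\<dots> \<le> real (card ?Y) * (9 / (2 * tent_mass N))"
    using N k m by (intro sum_bounded_above feedback_chi_square_term) auto
  \<comment> \<open>There are \<open>2 * N + k + 1 \<le> 4 * N\<close> outcomes, each contributing
    at most 9 over twice a mass of order \<open>N^3\<close>.\<close>
  also have "\<dots> \<le> (4 * real N) * (9 / (2 * (real N ^ 3 / 3)))"
  proof (intro mult_mono divide_left_mono)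
    show "real (card ?Y) \<le> 4 * real N"
      using N k by simp
  qed (use N tent_mass_ge[of N] tent_mass_pos[OF N] in auto)
  also have "\<dots> = 54 / (real N)\<^sup>2"
    using N by (simp add: power2_eq_square power3_eq_cube field_simps)
  finally show ?thesis .
qed

section \<open>Random losses with hidden arms\<close>

text \<open>Tasks and arms are counted from 0, coordinates of vectors from 1.\<close>

definition arm :: "nat \<Rightarrow> nat \<Rightarrow> nat \<Rightarrow> nat" where
  "arm n j i = j * n + i + 1"

definition matches :: "nat \<Rightarrow> nat \<Rightarrow> (nat \<Rightarrow> nat) \<Rightarrow> vector \<Rightarrow> nat" where
  "matches n k a x = card {j \<in> {..<k}. x (arm n j (a j)) = 1}"

definition chosen_arms :: "nat \<Rightarrow> nat \<Rightarrow> (nat \<Rightarrow> nat) \<Rightarrow> nat set" where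
  "chosen_arms n k a = (\<lambda>j. arm n j (a j)) ` {..<k}"

text \<open>The comparator of the regret bound. Restricting it to \<open>{1..k * n}\<close> makes it
  extensional, as members of the action set must be.\<close>

definition arm_vector :: "nat \<Rightarrow> nat \<Rightarrow> (nat \<Rightarrow> nat) \<Rightarrow> vector" where
  "arm_vector n k a = (\<lambda>i\<in>{1..k * n}. of_bool (i \<in> chosen_arms n k a))"

lemma arm_inject:
  assumes "i < n" "i' < n"
  shows "arm n j i = arm n j' i' \<longleftrightarrow> j = j' \<and> i = i'"
proof
  assume "arm n j i = arm n j' i'"
  then have "(j * n + i) div n = (j' * n + i') div n" "(j * n + i) mod n = (j' * n + i') mod n"
    by (simp_all add: arm_def)
  then show "j = j' \<and> i = i'" using assms by simp
qed simp

lemma arm_le: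
  assumes "j < k" "i < n"
  shows "arm n j i \<in> {1..k * n}"
proof -
  have "j * n + n \<le> k * n"
    using assms mult_le_mono1[of "Suc j" k n] by simp
  then show ?thesis using assms by (simp add: arm_def)
qed

lemma arm_mem_chosen:
  assumes "i < n" "j < k" "a \<in> {..<k} \<rightarrow> {..<n}"
  shows "arm n j i \<in> chosen_arms n k a \<longleftrightarrow> i = a j"
  using assms by (auto simp: chosen_arms_def arm_inject Pi_iff)

lemma sum_arms: "(\<Sum>i = 1..k * n. f i) = (\<Sum>j<k. \<Sum>i<n. f (arm n j i))" for f :: "nat \<Rightarrow> real"
proof -
  have "(\<Sum>i = 1..k * n. f i) = (\<Sum>i<k * n. f (Suc i))"
    by (rule sum.reindex_bij_witness[of _ Suc "\<lambda>i. i - 1"]) auto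
  also have "\<dots> = (\<Sum>j<k. \<Sum>i = j * n..<j * n + n. f (Suc i))"
    by (rule sum.nat_group[symmetric])
  also have "\<dots> = (\<Sum>j<k. \<Sum>i<n. f (arm n j i))"
  proof (rule sum.cong)
    show "(\<Sum>i = j * n..<j * n + n. f (Suc i)) = (\<Sum>i<n. f (arm n j i))" for j
      by (rule sum.reindex_bij_witness[of _ "\<lambda>i. j * n + i" "\<lambda>i. i - j * n"]) (auto simp: arm_def)
  qed simp
  finally show ?thesis .
qed

lemma sum_block:
  "(\<Sum>i = (Suc j - 1) * n + 1..Suc j * n. f i) = (\<Sum>i<n. f (arm n j i))" for f :: "nat \<Rightarrow> real"
  by (rule sum.reindex_bij_witness[of _ "arm n j" "\<lambda>i. i - (j * n + 1)"]) (auto simp: arm_def)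

lemma multitask_actions_iff:
  assumes "k > 0"
  shows "x \<in> multitask_actions (k * n) k \<longleftrightarrow>
    x \<in> {1..k * n} \<rightarrow>\<^sub>E {0, 1} \<and> (\<forall>j<k. (\<Sum>i<n. x (arm n j i)) = 1)"
proof -
  have "(\<forall>j\<in>Suc ` {..<k}. Q j) \<longleftrightarrow> (\<forall>j<k. Q (Suc j))" for Q
    by auto
  then have "(\<forall>j\<in>{1..k}. (\<Sum>i = (j - 1) * n + 1..j * n. x i) = 1) \<longleftrightarrow>
      (\<forall>j<k. (\<Sum>i = (Suc j - 1) * n + 1..Suc j * n. x i) = 1)"
    by (simp only: image_Suc_lessThan)
  also have "\<dots> \<longleftrightarrow> (\<forall>j<k. (\<Sum>i<n. x (arm n j i)) = 1)"
    by (simp only: sum_block)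
  finally show ?thesis
    using assms by (simp add: multitask_actions_def Let_def)
qed

lemma action_arm_01:
  assumes "x \<in> multitask_actions (k * n) k" "k > 0" "j < k" "i < n"
  shows "x (arm n j i) = 0 \<or> x (arm n j i) = 1"
  using assms(1) arm_le[OF assms(3,4)]
  by (auto simp: multitask_actions_iff[OF assms(2)] dest: PiE_mem)

lemma real_matches:
  assumes "x \<in> multitask_actions (k * n) k" "k > 0" "a \<in> {..<k} \<rightarrow> {..<n}"
  shows "real (matches n k a x) = (\<Sum>j<k. x (arm n j (a j)))"
proof -
  have "(\<Sum>j<k. x (arm n j (a j))) = (\<Sum>j<k. of_bool (x (arm n j (a j)) = 1))"
    using action_arm_01[OF assms(1,2)] assms(3) by (intro sum.cong) (force simp: Pi_iff)+
  also have "\<dots> = real (matches n k a x)"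
    by (simp add: matches_def Int_def)
  finally show ?thesis by simp
qed

lemma matches_le: "matches n k a x \<le> k"
proof -
  have "card {j \<in> {..<k}. x (arm n j (a j)) = 1} \<le> card {..<k}"
    by (intro card_mono) auto
  then show ?thesis by (simp add: matches_def)
qed

lemma arm_vector_arm:
  assumes "i < n" "j < k" "a \<in> {..<k} \<rightarrow> {..<n}"
  shows "arm_vector n k a (arm n j i) = of_bool (i = a j)"
  using arm_le[OF assms(2,1)] arm_mem_chosen[OF assms] by (simp add: arm_vector_def)

lemma arm_vector_mem:
  assumes "k > 0" "a \<in> {..<k} \<rightarrow> {..<n}"
  shows "arm_vector n k a \<in> multitask_actions (k * n) k"
proof -
  have "(\<Sum>i<n. arm_vector n k a (arm n j i)) = 1" if "j < k" for j
  proof -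
    have "(\<Sum>i<n. arm_vector n k a (arm n j i)) = (\<Sum>i<n. of_bool (i = a j))"
      using assms(2) that by (intro sum.cong) (simp_all add: arm_vector_arm)
    also have "{..<n} \<inter> {i. i = a j} = {a j}"
      using assms(2) that by (auto simp: Pi_iff)
    then have "(\<Sum>i<n. of_bool (i = a j)) = (1 :: real)" by simp
    finally show ?thesis .
  qed
  then show ?thesis
    using assms by (auto simp: multitask_actions_iff arm_vector_def)
qed

lemma matches_arm_vector:
  assumes "a \<in> {..<k} \<rightarrow> {..<n}"
  shows "matches n k a (arm_vector n k a) = k"
proof -
  have "{j \<in> {..<k}. arm_vector n k a (arm n j (a j)) = 1} = {..<k}"
    using assms by (auto simp: arm_vector_arm Pi_iff)
  then show ?thesis by (simp add: matches_def)
qed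

text \<open>
  All coordinates share the noise \<open>w\<close>, so that the total loss of \<open>k\<close> arms has noise of order \<open>k\<close>;
  the grid step \<open>k / (4 N)\<close> of the observed loss equals the advantage of a good arm.
\<close>

definition seed_loss :: "nat \<Rightarrow> nat \<Rightarrow> nat \<Rightarrow> (nat \<Rightarrow> nat) \<Rightarrow> int \<times> bool \<Rightarrow> vector" where
  "seed_loss n k N a s i = 1 / 2 + real_of_int (fst s) / (4 * real N)
     - real k / (4 * real N) * of_bool (snd s \<and> i \<in> chosen_arms n k a)"

definition rescale :: "nat \<Rightarrow> nat \<Rightarrow> int \<Rightarrow> real" where
  "rescale k N y = real k / 2 + real k / (4 * real N) * real_of_int y"

text \<open>An action takes exactly one arm per task, so the common shift is counted
  \<open>k\<close> times and each hidden arm saves one grid step. The observation therefore depends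
  on the action only through its number of matches.\<close>

lemma dot_seed_loss:
  assumes "x \<in> multitask_actions (k * n) k" "k > 0" "a \<in> {..<k} \<rightarrow> {..<n}"
  shows "dot (k * n) (seed_loss n k N a (w, b)) x =
    rescale k N (w - (if b then int (matches n k a x) else 0))"
proof -
  have one: "(\<Sum>i<n. x (arm n j i)) = 1" if "j < k" for j
    using assms(1,2) that by (simp add: multitask_actions_iff)
  let ?c = "1 / 2 + real_of_int w / (4 * real N)" and ?e = "real k / (4 * real N) * of_bool b"
  have "dot (k * n) (seed_loss n k N a (w, b)) x =
    (\<Sum>j<k. \<Sum>i<n. ?c * x (arm n j i) - ?e * (of_bool (i = a j) * x (arm n j i)))"
    unfolding dot_def sum_arms
    by (intro sum.cong refl) (simp add: seed_loss_def arm_mem_chosen assms(3) algebra_simps)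
  also have "\<dots> = (\<Sum>j<k. ?c * (\<Sum>i<n. x (arm n j i)) - ?e * (\<Sum>i<n. of_bool (i = a j) * x (arm n j i)))"
    by (simp only: sum_subtractf sum_distrib_left)
  also have "\<dots> = (\<Sum>j<k. ?c - ?e * x (arm n j (a j)))"
  proof (intro sum.cong refl)
    fix j assume "j \<in> {..<k}"
    then have j: "j < k" by simp
    have "(\<Sum>i<n. of_bool (i = a j) * x (arm n j i)) = (\<Sum>i\<in>{a j}. of_bool (i = a j) * x (arm n j i))"
      using assms(3) j by (intro sum.mono_neutral_right) (auto simp: Pi_iff)
    then show "?c * (\<Sum>i<n. x (arm n j i)) - ?e * (\<Sum>i<n. of_bool (i = a j) * x (arm n j i)) =
        ?c - ?e * x (arm n j (a j))"
      by (simp add: one[OF j])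
  qed
  also have "\<dots> = real k * ?c - ?e * (\<Sum>j<k. x (arm n j (a j)))"
    by (simp add: sum_subtractf sum_distrib_left sum_divide_distrib)
  also have "\<dots> = rescale k N (w - (if b then int (matches n k a x) else 0))"
    unfolding real_matches[OF assms, symmetric]
    by (cases b) (simp_all add: rescale_def ring_distribs add_divide_distrib diff_divide_distrib)
  finally show ?thesis .
qed

text \<open>The shift is at most 1/4 in absolute value, and \<open>k \<le> N\<close> bounds the
  saving by 1/4, so the loss stays within 1/2 of the centre 1/2.\<close>

lemma seed_loss_bounds:
  assumes "k \<le> N" "N > 0" "fst s \<in> {- int N..int N}"
  shows "seed_loss n k N a s i \<in> {0..1}"
proof -
  have "\<bar>real_of_int (fst s)\<bar> \<le> real N" using assms(3) by auto
  then have "\<bar>real_of_int (fst s) / (4 * real N)\<bar> \<le> 1 / 4"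
    using assms(2) by (simp add: field_simps)
  moreover have "real k / (4 * real N) * of_bool (snd s \<and> i \<in> chosen_arms n k a) \<le> 1 / 4"
    "0 \<le> real k / (4 * real N) * of_bool (snd s \<and> i \<in> chosen_arms n k a)"
    using assms(1,2) by (simp_all add: field_simps)
  ultimately show ?thesis
    unfolding seed_loss_def atLeastAtMost_iff by linarith
qed

section \<open>Coupling of random seeds with the learner's observations\<close>

abbreviation seeds :: "nat \<Rightarrow> (int \<times> bool) set" where
  "seeds N \<equiv> {- int N..int N} \<times> UNIV"

text \<open>Seeds are independent and identically distributed; the ignored history argument fits
  them into the locale \<open>kernel\<close>. The factor 1/2 is the coin.\<close>

definition seed_prob :: "nat \<Rightarrow> (int \<times> bool) list \<Rightarrow> int \<times> bool \<Rightarrow> real" where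
  "seed_prob N h s = noise N (fst s) / 2"

text \<open>The losses are a function of the seeds alone, so each seed list is an oblivious
  environment. Rounds count from 1, list positions from 0.\<close>

definition losses :: "nat \<Rightarrow> nat \<Rightarrow> nat \<Rightarrow> (nat \<Rightarrow> nat) \<Rightarrow> (int \<times> bool) list \<Rightarrow> nat \<Rightarrow> vector" where
  "losses n k N a \<sigma> t = seed_loss n k N a (\<sigma> ! (t - 1))"

lemma sum_seeds:
  "(\<Sum>s\<in>seeds N. f s) = (\<Sum>w = - int N..int N. f (w, False) + f (w, True))" for f :: "_ \<Rightarrow> real"
  by (simp add: sum.cartesian_product' UNIV_bool)

lemma kernel_seed_prob: "N > 0 \<Longrightarrow> kernel (seeds N) (seed_prob N)"
  by standard (simp_all add: seed_prob_def noise_nonneg sum_seeds sum_noise)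

text \<open>A deterministic learner. Averaging over its law \<open>P\<close> is postponed to
  \<open>exists_hard_losses\<close>.\<close>

locale play =
  fixes n k N :: nat and A :: algorithm
  assumes k: "k > 0" and kN: "k \<le> N"
    and A: "A h \<in> multitask_actions (k * n) k"
begin

lemma N: "N > 0"
  using k kN by simp

definition act :: "int list \<Rightarrow> vector" where
  "act h = A (map (rescale k N) h)"

abbreviation Y :: "int set" where
  "Y \<equiv> {- int N - int k..int N}"

definition env :: "(nat \<Rightarrow> nat) \<Rightarrow> int list \<Rightarrow> int \<Rightarrow> real" where
  "env a h = feedback N (matches n k a (act h))"

lemma act_mem: "act h \<in> multitask_actions (k * n) k"
  by (simp add: act_def A)

lemma kernel_feedback:
  assumes "\<And>h. m h \<le> k"
  shows "kernel Y (\<lambda>h. feedback N (m h))"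
  by standard (use assms N in \<open>auto simp: feedback_nonneg intro: sum_feedback_1\<close>)

lemma kernel_env: "kernel Y (env a)"
  unfolding env_def by (rule kernel_feedback) (rule matches_le)

definition out :: "(nat \<Rightarrow> nat) \<Rightarrow> int list \<Rightarrow> int \<times> bool \<Rightarrow> int" where
  "out a h s = fst s - (if snd s then int (matches n k a (act h)) else 0)"

primrec outs :: "(nat \<Rightarrow> nat) \<Rightarrow> (int \<times> bool) list \<Rightarrow> nat \<Rightarrow> int list" where
  "outs a \<sigma> 0 = []"
| "outs a \<sigma> (Suc t) = outs a \<sigma> t @ [out a (outs a \<sigma> t) (\<sigma> ! t)]"

lemma length_outs [simp]: "length (outs a \<sigma> t) = t"
  by (induction t) auto

lemma outs_append: "t \<le> length \<sigma> \<Longrightarrow> outs a (\<sigma> @ \<tau>) t = outs a \<sigma> t"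
  by (induction t) (auto simp: nth_append)

lemma outs_nth: "t < T \<Longrightarrow> outs a \<sigma> T ! t = out a (outs a \<sigma> t) (\<sigma> ! t)"
  by (induction T) (auto simp: nth_append less_Suc_eq)

lemma sum_seeds_out:
  "(\<Sum>s\<in>seeds N. seed_prob N \<sigma> s * G (out a h s)) = (\<Sum>y\<in>Y. env a h y * G y)"
  unfolding env_def sum_feedback[OF matches_le] sum_seeds
  by (simp add: seed_prob_def out_def)

text \<open>The outcomes induced by independent seeds follow the adaptive kernel
  \<open>env a\<close>. The induction generalises over \<open>F\<close>, since averaging the last
  outcome yields another function of the shorter history.\<close>

lemma expect_outs:
  "kernel.expect (seeds N) (seed_prob N) T (\<lambda>\<sigma>. F (outs a \<sigma> T)) = kernel.expect Y (env a) T F"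
proof -
  interpret Z: kernel "seeds N" "seed_prob N" by (rule kernel_seed_prob[OF N])
  interpret E: kernel Y "env a" by (rule kernel_env)
  show ?thesis
  proof (induction T arbitrary: F)
    case (Suc T)
    have "Z.expect (Suc T) (\<lambda>\<sigma>. F (outs a \<sigma> (Suc T))) =
      Z.expect T (\<lambda>\<sigma>. \<Sum>s\<in>seeds N. seed_prob N \<sigma> s * F (outs a \<sigma> T @ [out a (outs a \<sigma> T) s]))"
      unfolding Z.expect_Suc
      by (intro Z.expect_cong sum.cong refl) (auto simp: seqs_def outs_append nth_append)
    also have "\<dots> = Z.expect T (\<lambda>\<sigma>. \<Sum>y\<in>Y. env a (outs a \<sigma> T) y * F (outs a \<sigma> T @ [y]))"
      using sum_seeds_out[where G = "\<lambda>y. F (_ @ [y])"] by simp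
    also have "\<dots> = E.expect (Suc T) F"
      unfolding E.expect_Suc by (rule Suc)
    finally show ?case .
  qed simp
qed

lemma observations_losses:
  assumes "a \<in> {..<k} \<rightarrow> {..<n}"
  shows "observations (k * n) A (losses n k N a \<sigma>) t = map (rescale k N) (outs a \<sigma> t)"
proof (induction t)
  case (Suc t)
  then show ?case
    using dot_seed_loss[OF A k, where N = N and w = "fst (\<sigma> ! t)" and b = "snd (\<sigma> ! t)" and a = a] assms
    by (simp add: losses_def out_def act_def)
qed simp

lemma total_loss_losses:
  assumes "a \<in> {..<k} \<rightarrow> {..<n}"
  shows "total_loss (k * n) T A (losses n k N a \<sigma>) = (\<Sum>t<T. rescale k N (outs a \<sigma> T ! t))"
proof -
  have "total_loss (k * n) T A (losses n k N a \<sigma>) =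
      (\<Sum>t<T. dot (k * n) (losses n k N a \<sigma> (Suc t)) (A (observations (k * n) A (losses n k N a \<sigma>) t)))"
    unfolding total_loss_def action_def
    by (rule sum.reindex_bij_witness[of _ Suc "\<lambda>t. t - 1"]) auto
  also have "\<dots> = (\<Sum>t<T. rescale k N (outs a \<sigma> T ! t))"
  proof (intro sum.cong refl)
    fix t assume "t \<in> {..<T}"
    then show "dot (k * n) (losses n k N a \<sigma> (Suc t)) (A (observations (k * n) A (losses n k N a \<sigma>) t)) =
        rescale k N (outs a \<sigma> T ! t)"
      using dot_seed_loss[OF A k, where N = N and w = "fst (\<sigma> ! t)" and b = "snd (\<sigma> ! t)" and a = a] assms
      by (simp add: losses_def outs_nth out_def act_def observations_losses[OF assms])
  qed
  finally show ?thesis .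
qed

text \<open>The coin halves the value of a match: the mean outcome is \<open>- m / 2\<close>, and a
  grid step of \<open>k / (4 N)\<close> turns this into \<open>k / (8 N)\<close> saved per
  match.\<close>

lemma expect_total_loss:
  assumes "a \<in> {..<k} \<rightarrow> {..<n}"
  shows "kernel.expect (seeds N) (seed_prob N) T (\<lambda>\<sigma>. total_loss (k * n) T A (losses n k N a \<sigma>)) =
    real T * (real k / 2) - real k / (8 * real N) *
      kernel.expect Y (env a) T (\<lambda>h. \<Sum>t<T. real (matches n k a (act (take t h))))"
proof -
  interpret E: kernel Y "env a" by (rule kernel_env)
  have "kernel.expect (seeds N) (seed_prob N) T (\<lambda>\<sigma>. total_loss (k * n) T A (losses n k N a \<sigma>)) =
      E.expect T (\<lambda>h. \<Sum>t<T. rescale k N (h ! t))"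
    unfolding total_loss_losses[OF assms]
    by (rule expect_outs[where F = "\<lambda>h. \<Sum>t<T. rescale k N (h ! t)"])
  also have "\<dots> = E.expect T (\<lambda>h. \<Sum>t<T. \<Sum>y\<in>Y. env a (take t h) y * rescale k N y)"
    by (rule E.expect_additive)
  also have "(\<lambda>h. \<Sum>t<T. \<Sum>y\<in>Y. env a (take t h) y * rescale k N y) =
      (\<lambda>h. real T * (real k / 2) +
        (- (real k / (8 * real N))) * (\<Sum>t<T. real (matches n k a (act (take t h)))))"
  proof
    fix h
    have "(\<Sum>y\<in>Y. env a g y * rescale k N y) =
        real k / 2 - real k / (8 * real N) * real (matches n k a (act g))" for g
    proof -
      have "(\<Sum>y\<in>Y. env a g y * rescale k N y) =
          real k / 2 * (\<Sum>y\<in>Y. env a g y) + real k / (4 * real N) * (\<Sum>y\<in>Y. env a g y * real_of_int y)"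
        by (simp add: rescale_def ring_distribs sum.distrib sum_distrib_left mult_ac)
      also have "\<dots> = real k / 2 - real k / (8 * real N) * real (matches n k a (act g))"
        unfolding E.sum_1 unfolding env_def mean_feedback[OF matches_le N] by simp
      finally show ?thesis .
    qed
    then show "(\<Sum>t<T. \<Sum>y\<in>Y. env a (take t h) y * rescale k N y) =
      real T * (real k / 2) +
        (- (real k / (8 * real N))) * (\<Sum>t<T. real (matches n k a (act (take t h))))"
      by (simp add: sum_subtractf sum_distrib_left sum_negf)
  qed
  also have "E.expect T \<dots> = real T * (real k / 2) - real k / (8 * real N) *
      E.expect T (\<lambda>h. \<Sum>t<T. real (matches n k a (act (take t h))))"
    by (simp only: E.expect_add E.expect_const E.expect_cmult)
  finally show ?thesis .
qed

end

text \<open>The comparator has all \<open>k\<close> matches in every round, hence saves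
  \<open>k^2 / (8 N)\<close> per round on average.\<close>

lemma expect_arm_vector_loss:
  assumes "k > 0" "N > 0" "a \<in> {..<k} \<rightarrow> {..<n}"
  shows "kernel.expect (seeds N) (seed_prob N) T
      (\<lambda>\<sigma>. \<Sum>t = 1..T. dot (k * n) (losses n k N a \<sigma> t) (arm_vector n k a)) =
    real T * (real k / 2 - (real k)\<^sup>2 / (8 * real N))"
proof -
  interpret Z: kernel "seeds N" "seed_prob N" by (rule kernel_seed_prob) fact
  let ?f = "\<lambda>s. rescale k N (fst s - (if snd s then int k else 0))"
  have "(\<Sum>t = 1..T. dot (k * n) (losses n k N a \<sigma> t) (arm_vector n k a)) = (\<Sum>t<T. ?f (\<sigma> ! t))" for \<sigma>
  proof (rule sum.reindex_bij_witness[of _ Suc "\<lambda>t. t - 1"])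
    fix t
    show "?f (\<sigma> ! (t - 1)) = dot (k * n) (losses n k N a \<sigma> t) (arm_vector n k a)"
      using dot_seed_loss[OF arm_vector_mem[OF assms(1,3)] assms(1,3),
          where N = N and w = "fst (\<sigma> ! (t - 1))" and b = "snd (\<sigma> ! (t - 1))"]
      by (simp add: losses_def matches_arm_vector[OF assms(3)])
  qed auto
  then have "Z.expect T (\<lambda>\<sigma>. \<Sum>t = 1..T. dot (k * n) (losses n k N a \<sigma> t) (arm_vector n k a)) =
      Z.expect T (\<lambda>\<sigma>. \<Sum>t<T. \<Sum>s\<in>seeds N. seed_prob N (take t \<sigma>) s * ?f s)"
    by (simp add: Z.expect_additive[where f = "\<lambda>_. ?f"])
  also have "(\<Sum>s\<in>seeds N. seed_prob N h s * ?f s) = real k / 2 - (real k)\<^sup>2 / (8 * real N)" for h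
  proof -
    have "(\<Sum>s\<in>seeds N. seed_prob N h s * ?f s) =
      (\<Sum>w = - int N..int N. (real k / 2 - (real k)\<^sup>2 / (8 * real N)) * noise N w
         + real k / (4 * real N) * (noise N w * real_of_int w))"
      unfolding sum_seeds using assms(2) by (intro sum.cong refl)
        (simp add: seed_prob_def rescale_def power2_eq_square field_simps)
    also have "\<dots> = real k / 2 - (real k)\<^sup>2 / (8 * real N)"
      by (simp only: sum.distrib sum_distrib_left[symmetric] sum_noise[OF assms(2)] mean_noise) simp
    finally show ?thesis .
  qed
  then have "Z.expect T (\<lambda>\<sigma>. \<Sum>t<T. \<Sum>s\<in>seeds N. seed_prob N (take t \<sigma>) s * ?f s) =
      real T * (real k / 2 - (real k)\<^sup>2 / (8 * real N))"
    by (simp add: Z.expect_const)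
  finally show ?thesis .
qed

section \<open>Averaging over the hidden arms\<close>

lemma sum_sqrt_le:
  assumes "finite I" "\<And>i. i \<in> I \<Longrightarrow> f i \<ge> (0 :: real)"
  shows "(\<Sum>i\<in>I. sqrt (f i)) \<le> sqrt (real (card I) * (\<Sum>i\<in>I. f i))"
proof -
  have "(\<Sum>i\<in>I. \<bar>1 :: real\<bar> * \<bar>sqrt (f i)\<bar>) \<le> L2_set (\<lambda>_. 1) I * L2_set (\<lambda>i. sqrt (f i)) I"
    by (rule L2_set_mult_ineq)
  also have "\<dots> = sqrt (real (card I)) * sqrt (\<Sum>i\<in>I. f i)"
    using assms(2) by (simp add: L2_set_def)
  finally show ?thesis
    using assms(2) by (simp add: real_sqrt_mult)
qed

text \<open>The map sending \<open>(a, i)\<close> to \<open>(a(j := i), a j)\<close> is an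
  involution: redrawing one coordinate uniformly preserves the uniform average.\<close>

lemma sum_PiE_resample:
  fixes F :: "('a \<Rightarrow> 'b) \<Rightarrow> real"
  assumes "j \<in> I"
  shows "(\<Sum>a\<in>I \<rightarrow>\<^sub>E B. \<Sum>i\<in>B. F (a(j := i))) = real (card B) * (\<Sum>a\<in>I \<rightarrow>\<^sub>E B. F a)"
proof -
  have "(\<Sum>a\<in>I \<rightarrow>\<^sub>E B. \<Sum>i\<in>B. F (a(j := i))) = (\<Sum>(a, i)\<in>(I \<rightarrow>\<^sub>E B) \<times> B. F (a(j := i)))"
    by (rule sum.cartesian_product)
  also have "\<dots> = (\<Sum>(a, i)\<in>(I \<rightarrow>\<^sub>E B) \<times> B. F a)"
    using assms
    by (intro sum.reindex_bij_witness[of _ "\<lambda>(a, i). (a(j := i), a j)" "\<lambda>(a, i). (a(j := i), a j)"])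
      (auto simp: PiE_iff extensional_def)
  also have "\<dots> = real (card B) * (\<Sum>a\<in>I \<rightarrow>\<^sub>E B. F a)"
    by (simp add: sum_distrib_left flip: sum.cartesian_product)
  finally show ?thesis .
qed

section \<open>Comparison with the environment in which one task has no cheap arm\<close>

context play
begin

definition hits :: "nat \<Rightarrow> nat \<Rightarrow> nat \<Rightarrow> int list \<Rightarrow> real" where
  "hits T j i h = (\<Sum>t<T. act (take t h) (arm n j i))"

text \<open>The reference environment does not depend on \<open>a j\<close>, so a single reference
  serves all \<open>n\<close> positions of the hidden arm of task \<open>j\<close>.\<close>

definition env_without :: "(nat \<Rightarrow> nat) \<Rightarrow> nat \<Rightarrow> int list \<Rightarrow> int \<Rightarrow> real" where
  "env_without a j h = feedback N (card {j' \<in> {..<k} - {j}. act h (arm n j' (a j')) = 1})"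

lemma act_01: "j < k \<Longrightarrow> i < n \<Longrightarrow> act h (arm n j i) = 0 \<or> act h (arm n j i) = 1"
  using action_arm_01[OF act_mem k] by blast

lemma matches_upd:
  assumes j: "j < k" and i: "i < n"
  shows "matches n k (a(j := i)) (act h) =
    card {j' \<in> {..<k} - {j}. act h (arm n j' (a j')) = 1} + (if act h (arm n j i) = 1 then 1 else 0)"
proof -
  have "{j' \<in> {..<k}. act h (arm n j' ((a(j := i)) j')) = 1} =
    {j' \<in> {..<k} - {j}. act h (arm n j' (a j')) = 1} \<union> (if act h (arm n j i) = 1 then {j} else {})"
    using j by auto
  then show ?thesis
    unfolding matches_def by simp
qed

lemma card_matches_without_less: "j < k \<Longrightarrow> card {j' \<in> {..<k} - {j}. act h (arm n j' (a j')) = 1} < k"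
proof -
  assume j: "j < k"
  have "card {j' \<in> {..<k} - {j}. act h (arm n j' (a j')) = 1} \<le> card ({..<k} - {j})"
    by (intro card_mono) auto
  also have "\<dots> < k" using j by simp
  finally show ?thesis .
qed

lemma kernel_env_without: "j < k \<Longrightarrow> kernel Y (env_without a j)"
  unfolding env_without_def by (rule kernel_feedback) (rule less_imp_le[OF card_matches_without_less])

lemma hits_bounds:
  assumes "j < k" "i < n"
  shows "0 \<le> hits T j i h \<and> hits T j i h \<le> real T"
proof -
  have "0 \<le> act g (arm n j i) \<and> act g (arm n j i) \<le> 1" for g
    using act_01[OF assms, of g] by auto
  then show ?thesis
    using sum_bounded_above[of "{..<T}" "\<lambda>t. act (take t h) (arm n j i)" 1]
    by (auto simp: hits_def intro: sum_nonneg)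
qed

text \<open>The two environments differ only in rounds that pull arm \<open>i\<close> of task
  \<open>j\<close>, where the match count rises by one. The total entropy is thus at most
  \<open>54 / N^2\<close> times the expected number of such pulls in the reference
  environment.\<close>

lemma expect_hits_le:
  assumes j: "j < k" and i: "i < n"
  shows "kernel.expect Y (env (a(j := i))) T (hits T j i) \<le>
    kernel.expect Y (env_without a j) T (hits T j i) +
    2 * real T * (sqrt 54 / real N * sqrt (kernel.expect Y (env_without a j) T (hits T j i)))"
proof -
  interpret B: kernel Y "env_without a j" by (rule kernel_env_without[OF j])
  let ?m = "\<lambda>h. card {j' \<in> {..<k} - {j}. act h (arm n j' (a j')) = 1}"
  let ?D = "\<lambda>h. 54 / (real N)\<^sup>2 * act h (arm n j i)"
  have env: "env (a(j := i)) h = (if act h (arm n j i) = 1 then feedback N (Suc (?m h)) else env_without a j h)" for h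
    unfolding env_def env_without_def matches_upd[OF j i] by simp
  have "kernel.expect Y (env (a(j := i))) T (hits T j i) \<le> B.expect T (hits T j i) +
      2 * real T * sqrt (B.expect T (\<lambda>h. \<Sum>t<T. ?D (take t h)))"
  proof (rule change_of_measure[OF kernel_env_without[OF j] kernel_env])
    fix h y assume "env_without a j h y > 0"
    then show "env (a(j := i)) h y > 0"
      using card_matches_without_less[OF j, of h a] kN N
      by (auto simp: env env_without_def intro: feedback_pos_Suc)
  next
    fix h
    show "(\<Sum>y\<in>Y. env_without a j h y * ln (env_without a j h y / env (a(j := i)) h y)) \<le> ?D h"
    proof (cases "act h (arm n j i) = 1")
      case True
      then show ?thesis
        using feedback_entropy[OF N kN, of "?m h"] card_matches_without_less[OF j, of h a]
        by (simp add: env env_without_def)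
    next
      case False
      have "env_without a j h y * ln (env_without a j h y / env (a(j := i)) h y) = 0" for y
        using False by (cases "env_without a j h y = 0") (simp_all add: env)
      moreover have "act h (arm n j i) = 0"
        using act_01[OF j i, of h] False by simp
      ultimately show ?thesis by (simp only: sum.neutral_const)
    qed
  qed (rule hits_bounds[OF j i])
  also have "B.expect T (\<lambda>h. \<Sum>t<T. ?D (take t h)) = 54 / (real N)\<^sup>2 * B.expect T (hits T j i)"
    unfolding B.expect_cmult[symmetric] hits_def sum_distrib_left ..
  also have "sqrt \<dots> = sqrt 54 / real N * sqrt (B.expect T (hits T j i))"
    by (simp add: real_sqrt_mult real_sqrt_divide)
  finally show ?thesis .
qed

text \<open>In the reference environment the pulls of the \<open>n\<close> arms sum to
  \<open>T\<close>. By Cauchy-Schwarz their square roots sum to at most \<open>sqrt (n T)\<close>,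
  so the arms cannot all be explored well.\<close>

lemma sum_expect_hits_le:
  assumes j: "j < k" and n: "n \<ge> 2" and big: "3600 * real T \<le> real n * (real N)\<^sup>2"
  shows "(\<Sum>i<n. kernel.expect Y (env (a(j := i))) T (hits T j i)) \<le> 3 / 4 * real n * real T"
proof -
  interpret B: kernel Y "env_without a j" by (rule kernel_env_without[OF j])
  let ?b = "\<lambda>i. B.expect T (hits T j i)"
  have b0: "?b i \<ge> 0" if "i < n" for i
    using B.expect_mono[of T "\<lambda>_. 0" "hits T j i"] hits_bounds[OF j that] B.expect_const[of T 0] by simp
  have sum_b: "(\<Sum>i<n. ?b i) = real T"
  proof -
    have "(\<Sum>i<n. hits T j i h) = real T" for h
    proof -
      have "(\<Sum>i<n. act g (arm n j i)) = 1" for g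
        using act_mem[of g] j k by (simp add: multitask_actions_iff)
      then show ?thesis
        unfolding hits_def by (subst sum.swap) simp
    qed
    then show ?thesis
      by (simp add: B.expect_const flip: B.expect_sum)
  qed
  have "(\<Sum>i<n. sqrt (?b i)) \<le> sqrt (real n * real T)"
    using sum_sqrt_le[of "{..<n}" ?b] b0 sum_b by simp
  also have "\<dots> \<le> sqrt ((real n * real N / 60)\<^sup>2)"
    using mult_left_mono[OF big, of "real n"]
    by (intro real_sqrt_le_mono) (simp add: power2_eq_square field_simps)
  finally have sq: "(\<Sum>i<n. sqrt (?b i)) \<le> real n * real N / 60" by simp
  \<comment> \<open>The value 15/2 is a convenient upper bound: together with the 60 from
    \<open>big\<close> it gives \<open>2 * (15 / 2) / 60 = 1 / 4\<close>.\<close>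
  have "sqrt 54 \<le> sqrt ((15 / 2)\<^sup>2)"
    by (intro real_sqrt_le_mono) (simp add: power2_eq_square)
  then have s54: "sqrt 54 \<le> 15 / 2" by simp
  have "(\<Sum>i<n. kernel.expect Y (env (a(j := i))) T (hits T j i)) \<le>
      (\<Sum>i<n. ?b i + 2 * real T * (sqrt 54 / real N * sqrt (?b i)))"
    by (intro sum_mono expect_hits_le[OF j]) simp
  also have "\<dots> = real T + 2 * real T * (sqrt 54 / real N) * (\<Sum>i<n. sqrt (?b i))"
    by (simp add: sum.distrib sum_b sum_distrib_left mult_ac)
  also have "\<dots> \<le> real T + 2 * real T * ((15 / 2) / real N) * (real n * real N / 60)"
    using s54 sq b0 by (intro add_left_mono mult_mono divide_right_mono) (auto intro!: sum_nonneg)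
  also have "\<dots> = real T * (1 + real n / 4)"
    using N by (simp add: field_simps)
  \<comment> \<open>With at least two arms, \<open>1 \<le> n / 2\<close>.\<close>
  also have "\<dots> \<le> real T * (3 / 4 * real n)"
    using n by (intro mult_left_mono) auto
  finally show ?thesis by (simp add: mult_ac)
qed

text \<open>Matches are hits of the hidden arms summed over the tasks. For each task, resampling its
  hidden arm creates the inner sum over positions that \<open>sum_expect_hits_le\<close>
  bounds.\<close>

lemma sum_expect_matches_le:
  assumes n: "n \<ge> 2" and big: "3600 * real T \<le> real n * (real N)\<^sup>2"
  shows "(\<Sum>a\<in>{..<k} \<rightarrow>\<^sub>E {..<n}.
      kernel.expect Y (env a) T (\<lambda>h. \<Sum>t<T. real (matches n k a (act (take t h))))) \<le>
    real n ^ k * (3 / 4 * real k * real T)"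
proof -
  let ?I = "{..<k} \<rightarrow>\<^sub>E {..<n}"
  have "kernel.expect Y (env a) T (\<lambda>h. \<Sum>t<T. real (matches n k a (act (take t h)))) =
      (\<Sum>j<k. kernel.expect Y (env a) T (hits T j (a j)))" if "a \<in> ?I" for a
  proof -
    interpret E: kernel Y "env a" by (rule kernel_env)
    have "(\<Sum>t<T. real (matches n k a (act (take t h)))) = (\<Sum>j<k. hits T j (a j) h)" for h
      using that unfolding hits_def
      by (subst sum.swap) (auto intro!: sum.cong real_matches[OF act_mem k])
    then show ?thesis by (simp add: E.expect_sum)
  qed
  then have "(\<Sum>a\<in>?I. kernel.expect Y (env a) T (\<lambda>h. \<Sum>t<T. real (matches n k a (act (take t h))))) =
      (\<Sum>j<k. \<Sum>a\<in>?I. kernel.expect Y (env a) T (hits T j (a j)))"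
    by (subst sum.swap) (simp cong: sum.cong)
  also have "\<dots> \<le> (\<Sum>j<k. real n ^ k * (3 / 4 * real T))"
  proof (rule sum_mono)
    fix j assume "j \<in> {..<k}"
    then have j: "j < k" by simp
    let ?F = "\<lambda>a. kernel.expect Y (env a) T (hits T j (a j))"
    have "real n * (\<Sum>a\<in>?I. ?F a) = (\<Sum>a\<in>?I. \<Sum>i<n. ?F (a(j := i)))"
      using sum_PiE_resample[of j "{..<k}" ?F "{..<n}"] j by simp
    also have "\<dots> \<le> (\<Sum>a\<in>?I. 3 / 4 * real n * real T)"
      using sum_expect_hits_le[OF j n big] by (intro sum_mono) simp
    also have "\<dots> = real n * (real n ^ k * (3 / 4 * real T))"
      by (simp add: card_PiE)
    finally show "(\<Sum>a\<in>?I. ?F a) \<le> real n ^ k * (3 / 4 * real T)"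
      using n by simp
  qed
  also have "\<dots> = real n ^ k * (3 / 4 * real k * real T)"
    by simp
  finally show ?thesis .
qed

text \<open>Each missed match costs \<open>k / (8 N)\<close>, and on average at least a quarter of
  the \<open>k T\<close> possible matches is missed.\<close>

lemma average_regret:
  assumes n: "n \<ge> 2" and big: "3600 * real T \<le> real n * (real N)\<^sup>2"
  shows "real n ^ k * ((real k)\<^sup>2 * real T / (32 * real N)) \<le>
    (\<Sum>a\<in>{..<k} \<rightarrow>\<^sub>E {..<n}. kernel.expect (seeds N) (seed_prob N) T
      (\<lambda>\<sigma>. total_loss (k * n) T A (losses n k N a \<sigma>) -
        (\<Sum>t = 1..T. dot (k * n) (losses n k N a \<sigma> t) (arm_vector n k a))))"
proof -
  interpret Z: kernel "seeds N" "seed_prob N" by (rule kernel_seed_prob[OF N])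
  let ?I = "{..<k} \<rightarrow>\<^sub>E {..<n}" and ?c = "real k / (8 * real N)"
  let ?M = "\<lambda>a. kernel.expect Y (env a) T (\<lambda>h. \<Sum>t<T. real (matches n k a (act (take t h))))"
  have "Z.expect T (\<lambda>\<sigma>. total_loss (k * n) T A (losses n k N a \<sigma>) -
        (\<Sum>t = 1..T. dot (k * n) (losses n k N a \<sigma> t) (arm_vector n k a))) =
      ?c * (real k * real T) - ?c * ?M a" if "a \<in> ?I" for a
  proof -
    have a: "a \<in> {..<k} \<rightarrow> {..<n}" using that by auto
    have "Z.expect T (\<lambda>\<sigma>. total_loss (k * n) T A (losses n k N a \<sigma>) +
          (- 1) * (\<Sum>t = 1..T. dot (k * n) (losses n k N a \<sigma> t) (arm_vector n k a))) =
        ?c * (real k * real T) - ?c * ?M a"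
      unfolding Z.expect_add Z.expect_cmult expect_total_loss[OF a] expect_arm_vector_loss[OF k N a]
      by (simp add: power2_eq_square algebra_simps)
    then show ?thesis by simp
  qed
  then have "(\<Sum>a\<in>?I. Z.expect T (\<lambda>\<sigma>. total_loss (k * n) T A (losses n k N a \<sigma>) -
        (\<Sum>t = 1..T. dot (k * n) (losses n k N a \<sigma> t) (arm_vector n k a)))) =
      (\<Sum>a\<in>?I. ?c * (real k * real T) - ?c * ?M a)"
    by (intro sum.cong) auto
  also have "\<dots> = ?c * (real n ^ k * (real k * real T) - (\<Sum>a\<in>?I. ?M a))"
    by (simp only: sum_subtractf sum_distrib_left[symmetric]) (simp add: card_PiE right_diff_distrib)
  also have "\<dots> \<ge> ?c * (real n ^ k * (real k * real T) - real n ^ k * (3 / 4 * real k * real T))"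
    by (intro mult_left_mono diff_left_mono sum_expect_matches_le[OF n big]) simp
  also have "?c * (real n ^ k * (real k * real T) - real n ^ k * (3 / 4 * real k * real T)) =
      real n ^ k * ((real k)\<^sup>2 * real T / (32 * real N))"
    by (simp add: power2_eq_square field_simps)
  finally show ?thesis .
qed

end

section \<open>The lower bound\<close>

lemma (in kernel) exists_ge_expect: "\<exists>h\<in>seqs Y t. F h \<ge> expect t F"
proof (rule ccontr)
  assume "\<not> ?thesis"
  then have lt: "F h < expect t F" if "h \<in> seqs Y t" for h
    using that by force
  have "Y \<noteq> {}" using sum_1[of "[]"] by auto
  then obtain y where "y \<in> Y" by auto
  then have ne: "seqs Y t \<noteq> {}"
    by (auto simp: seqs_def intro!: exI[of _ "replicate t y"])
  have "expect t F \<le> expect t (\<lambda>_. Max (F ` seqs Y t))"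
    by (intro expect_mono) auto
  also have "\<dots> < expect t F"
    using lt ne by (simp add: expect_const)
  finally show False by simp
qed

lemma exists_ge_average:
  fixes f :: "'a \<Rightarrow> real"
  assumes "real (card I) * c \<le> sum f I" "card I > 0"
  shows "\<exists>x\<in>I. f x \<ge> c"
proof (rule ccontr)
  assume "\<not> ?thesis"
  then have "sum f I < sum (\<lambda>_. c) I"
    using assms(2) by (intro sum_strict_mono) (auto simp: card_gt_0_iff)
  then show False using assms(1) by simp
qed

section \<open>From deterministic to randomized learners\<close>

lemma integrable_total_loss:
  assumes P: "randomized_algorithm S P" and S: "countable S"
    and x: "\<And>x i. x \<in> S \<Longrightarrow> i \<in> {1..d} \<Longrightarrow> \<bar>x i\<bar> \<le> 1"
  shows "integrable P (\<lambda>A. total_loss d T A loss)"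
proof -
  interpret P: prob_space P using P by (simp add: randomized_algorithm_def)
  have m: "(\<lambda>A. A h) \<in> measurable P (count_space S)" for h
    using P by (simp add: randomized_algorithm_def)
  show ?thesis
  proof (rule P.integrable_const_bound)
    show "(\<lambda>A. total_loss d T A loss) \<in> borel_measurable P"
      by (rule borel_measurable_total_loss[OF S m])
    show "AE A in P. norm (total_loss d T A loss) \<le> (\<Sum>t = 1..T. \<Sum>i = 1..d. \<bar>loss t i\<bar>)"
    proof (rule AE_I2)
      fix A assume "A \<in> space P"
      then have A: "A h \<in> S" for h
        using measurable_space[OF m] by force
      have "\<bar>dot d (loss t) (A h)\<bar> \<le> (\<Sum>i = 1..d. \<bar>loss t i\<bar>)" for t h
      proof -
        have "\<bar>dot d (loss t) (A h)\<bar> \<le> (\<Sum>i = 1..d. \<bar>loss t i * A h i\<bar>)"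
          unfolding dot_def by (rule sum_abs)
        also have "\<dots> \<le> (\<Sum>i = 1..d. \<bar>loss t i\<bar> * 1)"
          unfolding abs_mult using x[OF A] by (intro sum_mono mult_left_mono) auto
        finally show ?thesis by simp
      qed
      then show "norm (total_loss d T A loss) \<le> (\<Sum>t = 1..T. \<Sum>i = 1..d. \<bar>loss t i\<bar>)"
        unfolding total_loss_def action_def real_norm_def
        by (intro order_trans[OF sum_abs] sum_mono) auto
    qed
  qed
qed

text \<open>The averaged bound holds for every deterministic learner, so it can be integrated over
  \<open>P\<close>. Only afterwards are \<open>a\<close> and the seeds fixed, so the resulting
  losses do not depend on the learner's random draw.\<close>

lemma exists_hard_losses:
  assumes P: "randomized_algorithm (multitask_actions (k * n) k) P"
    and k: "k > 0" and n: "n \<ge> 2" and kN: "k \<le> N"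
    and big: "3600 * real T \<le> real n * (real N)\<^sup>2"
  shows "\<exists>a \<sigma>. \<sigma> \<in> seqs (seeds N) T \<and>
    expected_regret (k * n) (multitask_actions (k * n) k) T P (losses n k N a \<sigma>) \<ge>
      (real k)\<^sup>2 * real T / (32 * real N)"
proof -
  let ?S = "multitask_actions (k * n) k" and ?I = "{..<k} \<rightarrow>\<^sub>E {..<n}"
    and ?c = "(real k)\<^sup>2 * real T / (32 * real N)"
  have N: "N > 0" using k kN by simp
  interpret Z: kernel "seeds N" "seed_prob N" by (rule kernel_seed_prob[OF N])
  interpret P: prob_space P using P by (simp add: randomized_algorithm_def)
  let ?L = "\<lambda>a \<sigma> A. total_loss (k * n) T A (losses n k N a \<sigma>)"
    and ?x = "\<lambda>a \<sigma>. \<Sum>t = 1..T. dot (k * n) (losses n k N a \<sigma> t) (arm_vector n k a)"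
  have S: "finite ?S" by (rule finite_multitask_actions)
  have int: "integrable P (?L a \<sigma>)" for a \<sigma>
  proof (rule integrable_total_loss[OF P countable_finite[OF S]])
    fix x i assume "x \<in> ?S" "i \<in> {1..k * n}"
    then show "\<bar>x i\<bar> \<le> 1"
      using PiE_mem[of x "{1..k * n}" "\<lambda>_. {0, 1}" i] by (auto simp: multitask_actions_iff[OF k])
  qed
  let ?R = "\<lambda>a \<sigma>. (\<integral>A. ?L a \<sigma> A \<partial>P) - ?x a \<sigma>"
  have "real n ^ k * ?c = (\<integral>A. real n ^ k * ?c \<partial>P)"
    by (simp add: P.prob_space)
  also have "\<dots> \<le> (\<integral>A. (\<Sum>a\<in>?I. Z.expect T (\<lambda>\<sigma>. ?L a \<sigma> A - ?x a \<sigma>)) \<partial>P)"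
  proof (rule integral_mono)
    show "integrable P (\<lambda>A. \<Sum>a\<in>?I. Z.expect T (\<lambda>\<sigma>. ?L a \<sigma> A - ?x a \<sigma>))"
      unfolding Z.expect_def using int by (intro Bochner_Integration.integrable_sum integrable_mult_right Bochner_Integration.integrable_diff) auto
    fix A assume "A \<in> space P"
    then have "A h \<in> ?S" for h
      using measurable_space[of "\<lambda>A. A h" P "count_space ?S" A] P
      by (simp add: randomized_algorithm_def)
    then interpret play n k N A
      using k kN by unfold_locales auto
    show "real n ^ k * ?c \<le> (\<Sum>a\<in>?I. Z.expect T (\<lambda>\<sigma>. ?L a \<sigma> A - ?x a \<sigma>))"
      by (rule average_regret[OF n big])
  qed simp
  also have "\<dots> = (\<Sum>a\<in>?I. Z.expect T (?R a))"
    unfolding Z.expect_def using int by (simp add: P.prob_space)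
  finally have "real (card ?I) * ?c \<le> (\<Sum>a\<in>?I. Z.expect T (?R a))"
    by (simp add: card_PiE)
  then obtain a where a: "a \<in> ?I" and "?c \<le> Z.expect T (?R a)"
    using exists_ge_average[of ?I ?c "\<lambda>a. Z.expect T (?R a)"] n by (auto simp: card_PiE)
  then obtain \<sigma> where \<sigma>: "\<sigma> \<in> seqs (seeds N) T" and R: "?c \<le> ?R a \<sigma>"
    using Z.exists_ge_expect[of T "?R a"] by force
  \<comment> \<open>The best fixed action in hindsight does at least as well as the hidden
    arms.\<close>
  have "(MIN x\<in>?S. \<Sum>t = 1..T. dot (k * n) (losses n k N a \<sigma> t) x) \<le> ?x a \<sigma>"
    using S a by (intro Min_le finite_imageI image_eqI[OF refl] arm_vector_mem k) auto
  then have "?c \<le> expected_regret (k * n) ?S T P (losses n k N a \<sigma>)"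
    using R unfolding expected_regret_def by linarith
  with \<sigma> show ?thesis by blast
qed

theorem theorem1:
  shows "\<exists>c > (0 :: real). \<forall>(k :: nat) (d :: nat) (T :: nat) (P :: algorithm measure).
    k > 0 \<longrightarrow> d > 0 \<longrightarrow> k dvd d \<longrightarrow> d div k \<ge> 2 \<longrightarrow> T \<ge> k * d \<longrightarrow>
    randomized_algorithm (multitask_actions d k) P \<longrightarrow>
    (\<exists>loss :: nat \<Rightarrow> vector. (\<forall>t \<in> {1..T}. \<forall>i \<in> {1..d}. loss t i \<in> {0..1}) \<and>
      expected_regret d (multitask_actions d k) T P loss \<ge>
        c * real k powr (3 / 2) * sqrt (real d * real T) * ln (real T) powr (- 1 / 2))"
proof (intro exI[of _ "1 / 4000 :: real"] conjI allI impI)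
  fix k d T :: nat and P :: "algorithm measure"
  assume k: "k > 0" and "d > 0" and "k dvd d" and n2: "d div k \<ge> 2" and T: "T \<ge> k * d"
    and P: "randomized_algorithm (multitask_actions d k) P"
  define n where "n = d div k"
  have d: "d = k * n" using \<open>k dvd d\<close> by (simp add: n_def)
  have n: "n \<ge> 2" using n2 by (simp add: n_def)
  \<comment> \<open>The scale at which entropy and number of pulls balance: \<open>N\<close> near
    \<open>60 * r\<close> yields \<open>big\<close>, and \<open>T \<ge> k * d\<close> means
    \<open>r \<ge> k\<close>, hence \<open>k \<le> N\<close>.\<close>
  define r where "r = sqrt (real T / real n)"
  define N where "N = nat \<lceil>60 * r\<rceil>"
  have "k * k * n \<le> T" using T by (simp add: d mult_ac)
  then have "real (k * k * n) \<le> real T" by (rule of_nat_mono)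
  then have "(real k)\<^sup>2 \<le> real T / real n"
    using n by (simp add: le_divide_eq power2_eq_square)
  then have kr: "real k \<le> r" unfolding r_def by (rule real_le_rsqrt)
  then have r1: "r \<ge> 1" using k by linarith
  \<comment> \<open>Rounding up adds at most 1, which is at most \<open>r\<close>.\<close>
  have Nr: "60 * r \<le> real N" "real N \<le> 61 * r"
    using r1 unfolding N_def by linarith+
  have r2: "r\<^sup>2 * real n = real T"
    using n by (simp add: r_def)
  have kN: "k \<le> N"
    using kr r1 Nr by linarith
  have big: "3600 * real T \<le> real n * (real N)\<^sup>2"
  proof -
    have "(60 * r)\<^sup>2 \<le> (real N)\<^sup>2" using Nr r1 by (intro power_mono) auto
    from mult_left_mono[OF this, of "real n"] show ?thesis
      by (simp add: r2[symmetric] power_mult_distrib mult_ac)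
  qed
  have "\<exists>a \<sigma>. \<sigma> \<in> seqs (seeds N) T \<and>
    expected_regret (k * n) (multitask_actions (k * n) k) T P (losses n k N a \<sigma>) \<ge>
      (real k)\<^sup>2 * real T / (32 * real N)"
    using P unfolding d by (rule exists_hard_losses[OF _ k n kN big])
  then obtain a \<sigma> where \<sigma>: "\<sigma> \<in> seqs (seeds N) T"
    and R: "(real k)\<^sup>2 * real T / (32 * real N) \<le>
      expected_regret d (multitask_actions d k) T P (losses n k N a \<sigma>)"
    unfolding d by blast
  have bounds: "losses n k N a \<sigma> t i \<in> {0..1}" if "t \<in> {1..T}" for t i
  proof -
    have "\<sigma> ! (t - 1) \<in> set \<sigma>"
      using \<sigma> that by (intro nth_mem) (auto simp: seqs_def)
    then have "\<sigma> ! (t - 1) \<in> seeds N" using \<sigma> by (auto simp: seqs_def)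
    then show ?thesis
      unfolding losses_def using kN k by (intro seed_loss_bounds) auto
  qed
  have "(1 / 4000) * real k powr (3 / 2) * sqrt (real d * real T) * ln (real T) powr (- 1 / 2)
     \<le> (real k)\<^sup>2 * real T / (32 * real N)"
  proof -
    have "real k powr (3 / 2) * sqrt (real k) = real k powr 2"
      using k by (simp flip: powr_half_sqrt powr_add)
    then have k2: "real k powr (3 / 2) * sqrt (real k) = (real k)\<^sup>2" by simp
    \<comment> \<open>The target rate \<open>k powr (3/2) * sqrt (d T)\<close> becomes
      \<open>k^2 n r\<close>, which equals \<open>k^2 T / r\<close>.\<close>
    have "sqrt (real d * real T) = sqrt (real k) * sqrt (real n * real T)"
      by (simp add: d real_sqrt_mult)
    also have "real n * real T = (real n * r)\<^sup>2"
      by (simp add: r2[symmetric] power2_eq_square)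
    finally have sq: "sqrt (real d * real T) = sqrt (real k) * (real n * r)"
      using r1 by simp
    have "2 \<le> k * d"
      using mult_le_mono[of 1 "k * k" 2 n] k n by (simp add: d)
    then have "real T \<ge> 2" using T by linarith
    then have "ln (real T) \<ge> ln 2" by simp
    \<comment> \<open>The threshold 1/4 is chosen because its power \<open>- 1 / 2\<close> is
      exactly 2.\<close>
    moreover have "ln 2 \<ge> (1 / 4 :: real)"
      using ln2_ge_two_thirds by simp
    ultimately have lT: "ln (real T) \<ge> 1 / 4" by linarith
    have "ln (real T) powr (- 1 / 2) \<le> (1 / 4) powr (- 1 / 2)"
      using lT by (intro powr_mono2') auto
    also have "\<dots> = (2 :: real)"
      by (simp add: powr_minus_divide powr_half_sqrt real_sqrt_divide)
    finally have l2: "ln (real T) powr (- 1 / 2) \<le> 2" .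
    have "(1 / 4000) * real k powr (3 / 2) * sqrt (real d * real T) * ln (real T) powr (- 1 / 2) =
        ln (real T) powr (- 1 / 2) * ((real k)\<^sup>2 * (real n * r)) / 4000"
      unfolding sq k2[symmetric] by simp
    also have "\<dots> \<le> 2 * ((real k)\<^sup>2 * (real n * r)) / 4000"
      using l2 r1 by (intro divide_right_mono mult_right_mono) auto
    \<comment> \<open>The constant 1/4000 is fixed here: \<open>2 / 4000 = 1 / 2000\<close> lies
      below \<open>1 / (32 * 61) = 1 / 1952\<close>.\<close>
    also have "\<dots> \<le> (real k)\<^sup>2 * real T / (32 * (61 * r))"
      using r1 by (simp add: r2[symmetric] power2_eq_square field_simps)
    also have "\<dots> \<le> (real k)\<^sup>2 * real T / (32 * real N)"
      using Nr r1 by (intro divide_left_mono) auto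
    finally show ?thesis .
  qed
  then have "(1 / 4000) * real k powr (3 / 2) * sqrt (real d * real T) * ln (real T) powr (- 1 / 2)
     \<le> expected_regret d (multitask_actions d k) T P (losses n k N a \<sigma>)"
    using R by (rule order_trans)
  with bounds show "\<exists>loss. (\<forall>t \<in> {1..T}. \<forall>i \<in> {1..d}. loss t i \<in> {0..1}) \<and>
      expected_regret d (multitask_actions d k) T P loss \<ge>
        1 / 4000 * real k powr (3 / 2) * sqrt (real d * real T) * ln (real T) powr (- 1 / 2)"
    by (intro exI[of _ "losses n k N a \<sigma>"]) auto
qed simp

end
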